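(* Let $l,J\in\mathbb N_{\ge0}$ and let $D_l:\mathrm{SO}(3)\to\mathrm U(V_l)$, $D_J:\mathrm{SO}(3)\to\mathrm U(V_J)$ be the complex irreducible representations given by the Wigner D-matrices. Then a basis of the space of $\mathrm{SO}(3)$-steerable kernels $K:S^2\to\mathrm{Hom}_{\mathbb C}(V_l,V_J)$ is given by the kernels $K_j$, for all integers $j$ with $|l-J|\le j\le l+J$, with matrix elements $$\langle JM|K_j(x)|ln\rangle=\sum_{m=-j}^{j}\langle JM|jm;ln\rangle\cdot\overline{Y_j^m(x)}\qquad(x\in S^2,\ -J\le M\le J,\ -l\le n\le l).$$
   Context: $Y_l^n:S^2\to\mathbb C$ ($l\ge0$, $-l\le n\le l$) are the standard complex spherical harmonics, orthonormal in $L^2_{\mathbb C}(S^2)$ (with respect to the normalized rotation-invariant measure). $V_l=\mathbb C^{2l+1}$ with standard basis $e^{-l},\dots,e^{l}$, and the unitary Wigner D-matrices $D_l(g)$, $g\in\mathrm{SO}(3)$, satisfy $Y_l^n(g^{-1}x)=\sum_{n'=-l}^l D_l^{n'n}(g)Y_l^{n'}(x)$. The $D_l$, $l\ge 0$, are up to equivalence all complex irreducible representations of $\mathrm{SO}(3)$, and $V_j\otimes V_l\cong\bigoplus_{J=|l-j|}^{l+j}V_J$. For $|l-j|\le J\le l+j$ the Clebsch-Gordan coefficients are $\langle JM|jm;ln\rangle=\langle\iota(e^M)\,|\,e^m\otimes e^n\rangle$, where $\iota:V_J\to V_j\otimes V_l$ is a fixed $\mathrm{SO}(3)$-equivariant linear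 isometric embedding (unique up to phase) and inner products are antilinear in the first argument. Matrix elements: $\langle JM|f|ln\rangle=\langle e^M|f(e^n)\rangle$ for linear $f:V_l\to V_J$. A steerable kernel is any function $K:S^2\to\mathrm{Hom}_{\mathbb C}(V_l,V_J)$ with $K(gx)=D_J(g)\circ K(x)\circ D_l(g)^{-1}$ for all $g\in\mathrm{SO}(3),x\in S^2$. *)

theory Defs
  imports "HOL-Analysis.Analysis" "HOL-Library.Function_Algebras"
    "HOL-Computational_Algebra.Polynomial"
begin

subsection \<open>Spherical harmonics\<close>

abbreviation S2 :: "(real ^ 3) set" where
  "S2 \<equiv> sphere 0 1"

definition legendre_poly :: "nat \<Rightarrow> real poly" where
  "legendre_poly l = smult (1 / (2 ^ l * fact l)) ((pderiv ^^ l) ([:-1, 0, 1:] ^ l))"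

text \<open>Associated Legendre function of order \<open>m \<ge> 0\<close>, with the Condon-Shortley phase.\<close>

definition assoc_legendre :: "nat \<Rightarrow> nat \<Rightarrow> real \<Rightarrow> real" where
  "assoc_legendre l m t = (-1) ^ m * sqrt (1 - t\<^sup>2) ^ m * poly ((pderiv ^^ m) (legendre_poly l)) t"

text \<open>For a unit vector \<open>x\<close> with polar angle \<open>\<theta>\<close> and azimuth \<open>\<phi>\<close> we have \<open>x $ 3 = cos \<theta>\<close> and
  \<open>x $ 1 + \<i> x $ 2 = sin \<theta> e\<^sup>i\<^sup>\<phi>\<close>. The azimuth is undefined at the poles, where \<open>Arg 0 = 0\<close> does no
  harm because \<open>assoc_legendre l m\<close> vanishes at \<open>1\<close> and \<open>-1\<close> for \<open>m > 0\<close>. The usual factor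
  \<open>1 / (4 \<pi>)\<close> under the root is absent because the measure on the sphere is normalized to
  total mass 1. Negative orders are given by \<open>Y\<^sub>l\<^sup>-\<^sup>m = (-1)\<^sup>m cnj Y\<^sub>l\<^sup>m\<close>.\<close>

definition sph_harm_nonneg :: "nat \<Rightarrow> nat \<Rightarrow> real ^ 3 \<Rightarrow> complex" where
  "sph_harm_nonneg l m x =
     of_real (sqrt ((2 * real l + 1) * fact (l - m) / fact (l + m)) * assoc_legendre l m (x $ 3))
       * cis (real m * Arg (Complex (x $ 1) (x $ 2)))"

definition sph_harm :: "nat \<Rightarrow> int \<Rightarrow> real ^ 3 \<Rightarrow> complex" where
  "sph_harm l n x =
     (if n \<ge> 0 then sph_harm_nonneg l (nat n) x
      else (-1) ^ nat (- n) * cnj (sph_harm_nonneg l (nat (- n)) x))"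


subsection \<open>Coordinate spaces and linear maps\<close>

text \<open>The space \<open>\<complex>\<^sup>I\<close> is modelled by the functions that vanish outside \<open>I\<close>, and a linear map
  between such spaces by a function that is zero outside its domain.\<close>

definition coord_space :: "'i set \<Rightarrow> ('i \<Rightarrow> complex) set" where
  "coord_space I = {v. \<forall>i. i \<notin> I \<longrightarrow> v i = 0}"

definition cinner :: "'i set \<Rightarrow> ('i \<Rightarrow> complex) \<Rightarrow> ('i \<Rightarrow> complex) \<Rightarrow> complex" where
  "cinner I u v = (\<Sum>i\<in>I. cnj (u i) * v i)"

definition ket :: "'i \<Rightarrow> 'i \<Rightarrow> complex" where
  "ket i = (\<lambda>k. if k = i then 1 else 0)"

definition tensor :: "('i \<Rightarrow> complex) \<Rightarrow> ('k \<Rightarrow> complex) \<Rightarrow> 'i \<times> 'k \<Rightarrow> complex" where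
  "tensor u v = (\<lambda>(a, b). u a * v b)"

definition hom_space :: "'i set \<Rightarrow> 'k set \<Rightarrow> (('i \<Rightarrow> complex) \<Rightarrow> ('k \<Rightarrow> complex)) set" where
  "hom_space I I' = {f.
     (\<forall>v \<in> coord_space I. f v \<in> coord_space I') \<and>
     (\<forall>u \<in> coord_space I. \<forall>v \<in> coord_space I. f (\<lambda>i. u i + v i) = (\<lambda>k. f u k + f v k)) \<and>
     (\<forall>c. \<forall>v \<in> coord_space I. f (\<lambda>i. c * v i) = (\<lambda>k. c * f v k)) \<and>
     (\<forall>v. v \<notin> coord_space I \<longrightarrow> f v = 0)}"

definition idx :: "nat \<Rightarrow> int set" where
  "idx l = {- int l..int l}"

abbreviation V :: "nat \<Rightarrow> (int \<Rightarrow> complex) set" where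
  "V l \<equiv> coord_space (idx l)"


subsection \<open>Wigner D-matrices\<close>

text \<open>\<open>wigner_D l g n' n\<close> is the entry in row \<open>n'\<close> and column \<open>n\<close>. The description is proper for
  every rotation \<open>g\<close>: the span of the spherical harmonics of degree \<open>l\<close> is rotation invariant,
  and they are linearly independent.\<close>

definition wigner_D :: "nat \<Rightarrow> real ^ 3 ^ 3 \<Rightarrow> int \<Rightarrow> int \<Rightarrow> complex" where
  "wigner_D l g = (THE D.
     (\<forall>n' n. n' \<notin> idx l \<or> n \<notin> idx l \<longrightarrow> D n' n = 0) \<and>
     (\<forall>n \<in> idx l. \<forall>x \<in> S2.
        sph_harm l n (matrix_inv g *v x) = (\<Sum>n'\<in>idx l. D n' n * sph_harm l n' x)))"

definition wigner_rep :: "nat \<Rightarrow> real ^ 3 ^ 3 \<Rightarrow> (int \<Rightarrow> complex) \<Rightarrow> (int \<Rightarrow> complex)" where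
  "wigner_rep l g v = (\<lambda>n'. \<Sum>n\<in>idx l. wigner_D l g n' n * v n)"

text \<open>The representation \<open>D\<^sub>j \<otimes> D\<^sub>l\<close> in coordinates.\<close>

definition tensor_rep ::
  "nat \<Rightarrow> nat \<Rightarrow> real ^ 3 ^ 3 \<Rightarrow> (int \<times> int \<Rightarrow> complex) \<Rightarrow> (int \<times> int \<Rightarrow> complex)" where
  "tensor_rep j l g t =
     (\<lambda>(a, b). \<Sum>(m, n)\<in>idx j \<times> idx l. wigner_D j g a m * wigner_D l g b n * t (m, n))"


subsection \<open>Clebsch-Gordan coefficients\<close>

definition equivariant_isometric_embedding ::
  "nat \<Rightarrow> nat \<Rightarrow> nat \<Rightarrow> ((int \<Rightarrow> complex) \<Rightarrow> (int \<times> int \<Rightarrow> complex)) \<Rightarrow> bool" where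
  "equivariant_isometric_embedding J j l \<iota> \<longleftrightarrow>
     \<iota> \<in> hom_space (idx J) (idx j \<times> idx l) \<and>
     (\<forall>u \<in> V J. \<forall>v \<in> V J. cinner (idx j \<times> idx l) (\<iota> u) (\<iota> v) = cinner (idx J) u v) \<and>
     (\<forall>g. rotation_matrix g \<longrightarrow>
        (\<forall>v \<in> V J. \<iota> (wigner_rep J g v) = tensor_rep j l g (\<iota> v)))"

text \<open>The coefficient \<open>\<langle>JM|jm;ln\<rangle>\<close> taken with respect to \<open>\<iota> : V\<^sub>J \<rightarrow> V\<^sub>j \<otimes> V\<^sub>l\<close>.\<close>

definition clebsch_gordan ::
  "((int \<Rightarrow> complex) \<Rightarrow> (int \<times> int \<Rightarrow> complex)) \<Rightarrow> nat \<Rightarrow> nat \<Rightarrow> int \<Rightarrow> int \<Rightarrow> int \<Rightarrow> complex" where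
  "clebsch_gordan \<iota> j l M m n = cinner (idx j \<times> idx l) (\<iota> (ket M)) (tensor (ket m) (ket n))"

definition matrix_element ::
  "nat \<Rightarrow> ((int \<Rightarrow> complex) \<Rightarrow> (int \<Rightarrow> complex)) \<Rightarrow> int \<Rightarrow> int \<Rightarrow> complex" where
  "matrix_element J f M n = cinner (idx J) (ket M) (f (ket n))"


subsection \<open>Steerable kernels\<close>

type_synonym kernel = "real ^ 3 \<Rightarrow> (int \<Rightarrow> complex) \<Rightarrow> (int \<Rightarrow> complex)"

text \<open>Functions \<open>S\<^sup>2 \<rightarrow> Hom(V\<^sub>l, V\<^sub>J)\<close>, extended by zero off the sphere.\<close>

definition kernel_space :: "nat \<Rightarrow> nat \<Rightarrow> kernel set" where
  "kernel_space l J =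
     {K. (\<forall>x \<in> S2. K x \<in> hom_space (idx l) (idx J)) \<and> (\<forall>x. x \<notin> S2 \<longrightarrow> K x = 0)}"

definition steerable_kernels :: "nat \<Rightarrow> nat \<Rightarrow> kernel set" where
  "steerable_kernels l J = {K \<in> kernel_space l J.
     \<forall>g. rotation_matrix g \<longrightarrow> (\<forall>x \<in> S2. \<forall>v \<in> V l.
       K (g *v x) v = wigner_rep J g (K x (inv_into (V l) (wigner_rep l g) v)))}"

definition kernel_scale :: "complex \<Rightarrow> kernel \<Rightarrow> kernel" where
  "kernel_scale c K = (\<lambda>x v M. c * K x v M)"

interpretation kernels: vector_space kernel_scale
  by unfold_locales (auto simp: kernel_scale_def fun_eq_iff algebra_simps)

end

(*
  With w = x_1 + i x_2 and z = x_3, the form (a^2 w + 2 a b z - b^2 cnj w)^l is a generating function of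
  the Y_l^n, with coefficients proportional to a^(l+n) b^(l-n). So the rotations act on spherical harmonics
  through their action on the isotropic vectors u = (a^2 - b^2, i (a^2 + b^2), 2 a b) of C^3. The Gram
  matrix of the coefficient vectors is a multiple of <u, u'>^l, hence rotation invariant, and the
  coefficient vectors span; therefore D_l exists and is unitary, without any integration over the sphere.
  Equivariance of the embeddings and unitarity make the kernels K_j steerable, and the linear independence
  of all the Y_j^m makes them independent. A steerable kernel is determined by its value at the north pole,
  which commutes with the rotations about the axis and hence is diagonal; so the space of steerable kernels
  has dimension at most 2 min l J + 1, which is the number of admissible j.
*)

theory Submission
  imports Defs
begin

subsection \<open>The generating function of the spherical harmonics\<close>

text \<open>\<open>wigner_D\<close> is a definite description, so every property of it has to wait
  for existence and uniqueness, which must come from the explicit Legendre formula. Uniqueness is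
  linear independence within one degree. For existence, the generating function is sampled at the
  2l+1 spinors (1, t) with t a root of unity. A rotation sends each sample to another spinor,
  determined only up to sign; the sign is harmless because the coefficient vector is homogeneous of
  even degree 2l. Inverting a discrete Fourier transform yields the entries of D_l, and the same
  inversion turns invariance of the Gram matrix into orthonormality of the columns. The
  normalization of the Y_l^n enters exactly there: it makes the Gram sum a binomial
  expansion.\<close>

lemma poly_eq_sum_atMost:
  fixes p :: "'a::comm_semiring_1 poly"
  assumes "degree p \<le> n"
  shows "poly p x = (\<Sum>i\<le>n. coeff p i * x ^ i)"
  unfolding poly_altdef using assms
  by (intro sum.mono_neutral_left) (auto simp: coeff_eq_0)

text \<open>Taylor's formula: the chain rule gives c^k for k derivatives of p(z + c X), and the
  constant coefficient of a k-th derivative is k! times the k-th coefficient.\<close>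

lemma coeff_pcompose_linear:
  fixes p :: "'a::field_char_0 poly"
  shows "coeff (pcompose p [:z, c:]) k = c ^ k * poly ((pderiv ^^ k) p) z / fact k"
proof -
  have "(pderiv ^^ k) (pcompose p [:z, c:]) = smult (c ^ k) (pcompose ((pderiv ^^ k) p) [:z, c:])"
    by (induction k) (simp_all add: pderiv_smult pderiv_pcompose pderiv_pCons mult.commute)
  then have "coeff ((pderiv ^^ k) (pcompose p [:z, c:])) 0 = c ^ k * poly ((pderiv ^^ k) p) z"
    by (simp add: poly_0_coeff_0[symmetric] poly_pcompose)
  then show ?thesis
    by (simp add: coeff_higher_pderiv pochhammer_fact[symmetric] field_simps)
qed

text \<open>If \<open>s\<^sup>2 = 1 - z\<^sup>2\<close>, then \<open>s (s + 2 z t - s t\<^sup>2) = 1 - (z - s t)\<^sup>2\<close>. By Taylor's formula the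
  coefficients of the \<open>l\<close>-th power in \<open>t\<close> are thus given by the derivatives of \<open>(1 - X\<^sup>2)\<^sup>l\<close> at \<open>z\<close>,
  as in Rodrigues' formula.\<close>

definition herglotz_poly :: "nat \<Rightarrow> real \<Rightarrow> real \<Rightarrow> real poly" where
  "herglotz_poly l s z = [:s, 2 * z, - s:] ^ l"

lemma degree_herglotz_poly: "degree (herglotz_poly l s z) \<le> 2 * l"
  unfolding herglotz_poly_def
  by (rule order_trans[OF degree_power_le]) (simp add: mult.commute)

lemma poly_herglotz_poly: "poly (herglotz_poly l s z) t = (s + 2 * z * t - s * t\<^sup>2) ^ l"
  by (simp add: herglotz_poly_def poly_power power2_eq_square algebra_simps)

text \<open>The substitution t -> -1/t multiplies s + 2 z t - s t^2 by -1/t^2, so reversing the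
  coefficients only introduces signs. This symmetry exchanges the orders n and -n.\<close>

lemma coeff_herglotz_poly_reflect:
  assumes "k \<le> 2 * l"
  shows "coeff (herglotz_poly l s z) (2 * l - k) = (-1) ^ (l + k) * coeff (herglotz_poly l s z) k"
proof -
  let ?G = "herglotz_poly l s z"
  define G' where "G' = (\<Sum>k\<le>2*l. monom ((-1) ^ (l + k) * coeff ?G k) (2 * l - k))"
  have "poly ?G t = poly G' t" if "t > 0" for t
  proof -
    have "poly G' t = (\<Sum>k\<le>2*l. (-1) ^ (l + k) * coeff ?G k * t ^ (2 * l - k))"
      by (simp add: G'_def poly_sum poly_monom)
    also have "\<dots> = (\<Sum>k\<le>2*l. (-1) ^ l * t ^ (2 * l) * (coeff ?G k * (- 1 / t) ^ k))"
    proof (intro sum.cong refl)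
      fix k assume "k \<in> {..2 * l}"
      then show "(-1) ^ (l + k) * coeff ?G k * t ^ (2 * l - k) =
          (-1) ^ l * t ^ (2 * l) * (coeff ?G k * (- 1 / t) ^ k)"
        unfolding power_divide using that by (simp add: power_add power_diff)
    qed
    also have "\<dots> = (-1) ^ l * t ^ (2 * l) * poly ?G (- 1 / t)"
      by (simp add: poly_eq_sum_atMost[OF degree_herglotz_poly] sum_distrib_left)
    also have "\<dots> = (- (t\<^sup>2) * (s + 2 * z * (- 1 / t) - s * (- 1 / t)\<^sup>2)) ^ l"
      by (simp add: poly_herglotz_poly power_mult_distrib power_mult flip: power_mult_distrib)
    also have "- (t\<^sup>2) * (s + 2 * z * (- 1 / t) - s * (- 1 / t)\<^sup>2) = s + 2 * z * t - s * t\<^sup>2"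
      using that by (simp add: field_simps power2_eq_square)
    finally show ?thesis by (simp add: poly_herglotz_poly)
  qed
  then have "{0<..} \<subseteq> {t. poly (?G - G') t = 0}" by auto
  then have "infinite {t. poly (?G - G') t = 0}"
    using infinite_Ioi finite_subset by blast
  then have "?G = G'" using poly_roots_finite[of "?G - G'"] by force
  then have "coeff ?G (2 * l - k) = coeff G' (2 * l - k)" by simp
  also have "\<dots> = (\<Sum>i\<le>2*l. if i = k then (-1) ^ (l + i) * coeff ?G i else 0)"
    unfolding G'_def coeff_sum coeff_monom using assms by (intro sum.cong) auto
  also have "\<dots> = (-1) ^ (l + k) * coeff ?G k" using assms by simp
  finally show ?thesis .
qed

lemma map_poly_of_real_mult:
  "map_poly complex_of_real (p * q) = map_poly complex_of_real p * map_poly complex_of_real q"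
  by (rule poly_eqI) (simp add: coeff_map_poly coeff_mult)

text \<open>Homogenization with t = B / A, the case A = 0 being separate. The exponents of A and B
  will become l + n and l - n.\<close>

lemma herglotz_poly_homogeneous:
  fixes A B :: complex
  shows "(\<Sum>k\<le>2*l. A ^ (2 * l - k) * B ^ k * of_real (coeff (herglotz_poly l s z) k)) =
    (A\<^sup>2 * of_real s + 2 * A * B * of_real z - B\<^sup>2 * of_real s) ^ l"
proof (cases "A = 0")
  case True
  have "(\<Sum>k\<le>2*l. A ^ (2 * l - k) * B ^ k * of_real (coeff (herglotz_poly l s z) k)) =
     (\<Sum>k\<le>2*l. if k = 2 * l then B ^ k * of_real (coeff (herglotz_poly l s z) k) else 0)"
    using True by (intro sum.cong) auto
  \<comment> \<open>The index is written \<open>2 * l - 0\<close> so that the reflection reads the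
    top coefficient off the constant one.\<close>
  also have "\<dots> = B ^ (2 * l) * of_real (coeff (herglotz_poly l s z) (2 * l - 0))" by simp
  also have "coeff (herglotz_poly l s z) (2 * l - 0) = (-1) ^ l * s ^ l"
    by (subst coeff_herglotz_poly_reflect) (auto simp: herglotz_poly_def coeff_0_power)
  finally show ?thesis using True
    by (simp add: power_mult power_mult_distrib[symmetric])
next
  case False
  let ?G = "map_poly complex_of_real (herglotz_poly l s z)"
  have "poly ?G (B / A) = (of_real s + 2 * of_real z * (B / A) - of_real s * (B / A)\<^sup>2) ^ l"
  proof -
    have "?G = [:of_real s, 2 * of_real z, - of_real s:] ^ l"
      unfolding herglotz_poly_def
      by (induction l) (simp add: map_poly_pCons, simp only: power_Suc map_poly_of_real_mult, simp add: map_poly_pCons)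
    then show ?thesis by (simp add: poly_power power2_eq_square algebra_simps)
  qed
  moreover have "degree ?G \<le> 2 * l"
    using degree_herglotz_poly by (metis degree_map_poly of_real_eq_0_iff)
  ultimately have "(\<Sum>k\<le>2*l. of_real (coeff (herglotz_poly l s z) k) * (B / A) ^ k) =
     (of_real s + 2 * of_real z * (B / A) - of_real s * (B / A)\<^sup>2) ^ l"
    using poly_eq_sum_atMost[of ?G "2 * l" "B / A"] by (simp add: coeff_map_poly)
  then have "(\<Sum>k\<le>2*l. A ^ (2 * l - k) * B ^ k * of_real (coeff (herglotz_poly l s z) k)) =
     A ^ (2 * l) * (of_real s + 2 * of_real z * (B / A) - of_real s * (B / A)\<^sup>2) ^ l"
    using False
    by (auto simp: sum_distrib_left power_diff power_divide field_simps intro!: sum.cong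
        dest!: sym[of "sum _ _"])
  also have "\<dots> = (A\<^sup>2 * (of_real s + 2 * of_real z * (B / A) - of_real s * (B / A)\<^sup>2)) ^ l"
    by (simp only: power_mult power_mult_distrib)
  also have "A\<^sup>2 * (of_real s + 2 * of_real z * (B / A) - of_real s * (B / A)\<^sup>2) =
     A\<^sup>2 * of_real s + 2 * A * B * of_real z - B\<^sup>2 * of_real s"
    using False by (simp add: field_simps power2_eq_square)
  finally show ?thesis .
qed

lemma pcompose_power: "pcompose (p ^ n) q = pcompose p q ^ n"
  by (induction n) (simp_all add: pcompose_mult pcompose_1)

lemma coeff_herglotz_poly_upper:
  assumes z: "z\<^sup>2 \<le> 1"
  shows "coeff (herglotz_poly l (sqrt (1 - z\<^sup>2)) z) (l + m) =
    2 ^ l * fact l / fact (l + m) * assoc_legendre l m z"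
proof -
  define s where "s = sqrt (1 - z\<^sup>2)"
  define q :: "real poly" where "q = [:-1, 0, 1:] ^ l"
  have s2: "s * s = 1 - z * z" using z by (simp add: s_def flip: power2_eq_square)
  have comp: "pcompose q [:z, c:] = (smult c ([:0, 1:] * [:2 * z, c:]) - [:1 - z * z:]) ^ l" for c
    by (simp add: q_def pcompose_power pcompose_pCons algebra_simps)
  have *: "coeff (herglotz_poly l s z) (l + m) = (-1) ^ m * s ^ m * poly ((pderiv ^^ (l + m)) q) z / fact (l + m)"
  proof (cases "s = 0")
    case False
    have "smult (s ^ l) (herglotz_poly l s z) = smult ((-1) ^ l) (pcompose q [:z, - s:])"
    proof -
      have "smult (-1) (smult (- s) ([:0, 1:] * [:2 * z, - s:]) - [:1 - z * z:]) = smult s [:s, 2 * z, - s:]"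
        by (simp add: s2)
      then show ?thesis
        unfolding herglotz_poly_def comp smult_power[symmetric] by (rule arg_cong[OF sym])
    qed
    then have "s ^ l * coeff (herglotz_poly l s z) (l + m) =
        (-1) ^ l * ((- s) ^ (l + m) * poly ((pderiv ^^ (l + m)) q) z / fact (l + m))"
      by (metis coeff_pcompose_linear coeff_smult)
    also have "\<dots> = s ^ l * ((-1) ^ m * s ^ m * poly ((pderiv ^^ (l + m)) q) z / fact (l + m))" (is "_ = _ * ?r")
    proof -
      have "(-1::real) ^ l * (-1) ^ l = 1" by (simp flip: power_mult_distrib)
      then show ?thesis unfolding power_minus[of s] power_add by (auto simp: field_simps)
    qed
    finally have "coeff (herglotz_poly l s z) (l + m) = ?r"
      using False by (simp only: mult_cancel_left power_eq_0_iff simp_thms)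
    then show ?thesis .
  next
    \<comment> \<open>At a pole the factor s^l cannot be cancelled. The polynomial is then (2 z
      X)^l, so among these coefficients only the one for m = 0 is nonzero, and the factor s^m kills
      the right side for the others.\<close>
    case True
    then have z1: "z * z = 1" using s2 by simp
    have mono: "[:0, 1::real:] ^ n = monom 1 n" for n
      by (simp add: monom_altdef)
    have "[:s, 2 * z, - s:] = monom (2 * z) 1"
      using True by (simp add: monom_altdef)
    then have herg: "herglotz_poly l s z = monom ((2 * z) ^ l) l"
      by (simp only: herglotz_poly_def monom_power mult_1)
    show ?thesis
    proof (cases "m = 0")
      case m: True
      \<comment> \<open>As z^2 = 1, the base (z + X)^2 - 1 factors as X (2 z + X), which exhibits
        the l-th coefficient.\<close>
      have "coeff (pcompose q [:z, 1:]) l = coeff (monom 1 l * [:2 * z, 1:] ^ l) l"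
        unfolding comp z1 mono[symmetric] power_mult_distrib[symmetric] by simp
      also have "\<dots> = (2 * z) ^ l" by (simp add: coeff_monom_mult coeff_0_power)
      finally have "poly ((pderiv ^^ l) q) z / fact l = (2 * z) ^ l"
        by (simp add: coeff_pcompose_linear)
      then show ?thesis using m herg by (simp add: power_mult_distrib)
    next
      case False
      then show ?thesis using True herg by simp
    qed
  qed
  have "(pderiv ^^ m) (legendre_poly l) = smult (1 / (2 ^ l * fact l)) ((pderiv ^^ (l + m)) q)"
    by (simp add: legendre_poly_def higher_pderiv_smult q_def funpow_add add.commute[of l m])
  then have "assoc_legendre l m z = (-1) ^ m * s ^ m * (poly ((pderiv ^^ (l + m)) q) z / (2 ^ l * fact l))"
    by (simp add: assoc_legendre_def s_def)
  then show ?thesis unfolding s_def[symmetric] * by simp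
qed

section \<open>Polar form of the spherical harmonics and the constants of the generating
  function\<close>

definition azimuthal :: "real ^ 3 \<Rightarrow> complex" where
  "azimuthal x = Complex (x $ 1) (x $ 2)"

text \<open>The real factor left after splitting off the azimuth. The sign in front absorbs the
  convention for negative orders, so that one phase e^(i n phi) serves both signs of n.\<close>

definition sph_polar :: "nat \<Rightarrow> int \<Rightarrow> real \<Rightarrow> real" where
  "sph_polar l n z = (if n \<ge> 0 then 1 else (-1) ^ nat (- n)) *
     sqrt ((2 * real l + 1) * fact (l - nat \<bar>n\<bar>) / fact (l + nat \<bar>n\<bar>)) * assoc_legendre l (nat \<bar>n\<bar>) z"

lemma sph_harm_polar:
  "sph_harm l n x = of_real (sph_polar l n (x $ 3)) * cis (of_int n * Arg (azimuthal x))"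
proof (cases "n \<ge> 0")
  case True
  then show ?thesis
    by (simp add: sph_harm_def sph_harm_nonneg_def sph_polar_def azimuthal_def)
next
  case False
  then show ?thesis
    by (simp add: sph_harm_def sph_harm_nonneg_def sph_polar_def azimuthal_def cis_cnj)
qed

lemma S2_coords: "x \<in> S2 \<longleftrightarrow> (x $ 1)\<^sup>2 + (x $ 2)\<^sup>2 + (x $ 3)\<^sup>2 = 1"
  by (simp add: norm_vec_def L2_set_def sum_3)

lemma norm_azimuthal:
  assumes "x \<in> S2"
  shows "cmod (azimuthal x) = sqrt (1 - (x $ 3)\<^sup>2)"
proof -
  have "(x $ 1)\<^sup>2 + (x $ 2)\<^sup>2 = 1 - (x $ 3)\<^sup>2" using assms unfolding S2_coords by simp
  then show ?thesis by (simp add: azimuthal_def cmod_def)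
qed

lemma S2_height:
  assumes "x \<in> S2"
  shows "(x $ 3)\<^sup>2 \<le> 1"
  using assms unfolding S2_coords by (smt (verit) zero_le_power2)

lemma azimuthal_polar: "azimuthal x = of_real (cmod (azimuthal x)) * cis (Arg (azimuthal x))"
  by (metis rcis_cmod_Arg rcis_def)

text \<open>\<open>2 ^ l * fact l\<close> undoes the Rodrigues factor, and the root combines with
  the one in Y_l^n to 1 / (l + |n|)!. The square is a constant times the binomial coefficient of 2l
  over l - n, the source of unitarity.\<close>

definition spin_norm :: "nat \<Rightarrow> int \<Rightarrow> real" where
  "spin_norm l n = (-1) ^ nat \<bar>n\<bar> * (2 ^ l * fact l /
     sqrt ((2 * real l + 1) * fact (nat (int l + n)) * fact (nat (int l - n))))"

text \<open>Up to signs and a common factor, the coordinates of the 2l-th symmetric power of (a, b)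
  in an orthonormal weight basis, known in physics as a spin coherent state.\<close>

definition spin_coeff :: "nat \<Rightarrow> complex \<Rightarrow> complex \<Rightarrow> int \<Rightarrow> complex" where
  "spin_coeff l a b n = of_real (spin_norm l n) * a ^ nat (int l + n) * b ^ nat (int l - n)"

lemma finite_idx [simp]: "finite (idx l)"
  by (simp add: idx_def)

lemma sum_idx: "(\<Sum>n\<in>idx l. f n) = (\<Sum>k\<le>2*l. f (int l - int k))"
  by (rule sum.reindex_bij_witness[where i = "\<lambda>k. int l - int k" and j = "\<lambda>n. nat (int l - n)"])
     (auto simp: idx_def)

text \<open>An order n < 0 hits the upper half of the coefficients, and the signs (-1)^|n| in
  \<open>spin_norm\<close> and \<open>sph_polar\<close> cancel. For n >= 0 the index is at most l,
  and the reflection supplies the sign of \<open>spin_norm\<close>.\<close>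

lemma spin_norm_polar:
  assumes n: "n \<in> idx l" and z: "z\<^sup>2 \<le> 1"
  shows "spin_norm l n * sph_polar l n z = coeff (herglotz_poly l (sqrt (1 - z\<^sup>2)) z) (nat (int l - n))"
proof -
  define m where "m = nat \<bar>n\<bar>"
  have m: "m \<le> l" using n by (auto simp: m_def idx_def)
  have sq: "fact l * sqrt ((2 * real l + 1) * fact (l - m) / fact (l + m)) /
      sqrt ((2 * real l + 1) * fact (l + m) * fact (l - m)) = fact l / fact (l + m)"
    by (simp add: real_sqrt_mult real_sqrt_divide)
  have upper: "coeff (herglotz_poly l (sqrt (1 - z\<^sup>2)) z) (l + m) =
      2 ^ l * (fact l * sqrt ((2 * real l + 1) * fact (l - m) / fact (l + m)) /
      sqrt ((2 * real l + 1) * fact (l + m) * fact (l - m))) * assoc_legendre l m z"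
    unfolding sq coeff_herglotz_poly_upper[OF z] by simp
  have sgn: "(-1::real) ^ m * (-1) ^ m = 1" by (simp flip: power_mult_distrib)
  show ?thesis
  proof (cases "n \<ge> 0")
    case True
    then have n': "n = int m" by (simp add: m_def)
    have "nat (int l - n) = 2 * l - (l + m)" "nat (int l + n) = l + m" "nat (int l - n) = l - m" "nat \<bar>n\<bar> = m"
      using m n' by auto
    moreover have "coeff (herglotz_poly l (sqrt (1 - z\<^sup>2)) z) (2 * l - (l + m)) =
        (-1) ^ m * coeff (herglotz_poly l (sqrt (1 - z\<^sup>2)) z) (l + m)"
      using m by (subst coeff_herglotz_poly_reflect) (auto simp: power_add)
    ultimately show ?thesis
      unfolding upper spin_norm_def sph_polar_def using True by (simp add: mult_ac)
  next
    case False
    then have n': "n = - int m" by (simp add: m_def)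
    have "nat (int l + n) = l - m" "nat (int l - n) = l + m" "nat \<bar>n\<bar> = m" "nat (- n) = m"
      using m n' by auto
    then have "spin_norm l n * sph_polar l n z = ((-1) ^ m * (-1) ^ m) *
        coeff (herglotz_poly l (sqrt (1 - z\<^sup>2)) z) (nat (int l - n))"
      unfolding spin_norm_def sph_polar_def using False upper by (simp add: mult_ac)
    then show ?thesis unfolding sgn by simp
  qed
qed

text \<open>The azimuthal phase e is absorbed into b: with k = l - n one has e^n = e^l e^(-k), so b
  becomes b / e and the identity reduces to azimuth zero. At the poles e = 1 and s = 0, so the
  factorization of \<open>azimuthal x\<close> stays valid.\<close>

theorem sph_harm_generating_function:
  assumes x: "x \<in> S2"
  shows "(\<Sum>n\<in>idx l. spin_coeff l a b n * sph_harm l n x) =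
    (a\<^sup>2 * azimuthal x + 2 * a * b * of_real (x $ 3) - b\<^sup>2 * cnj (azimuthal x)) ^ l"
proof -
  define e where "e = cis (Arg (azimuthal x))"
  define s where "s = sqrt (1 - (x $ 3)\<^sup>2)"
  have e0: "e \<noteq> 0" by (simp add: e_def)
  have w: "azimuthal x = of_real s * e" "cnj (azimuthal x) = of_real s / e"
  proof -
    show w: "azimuthal x = of_real s * e"
      using azimuthal_polar[of x] by (simp only: norm_azimuthal[OF x] s_def e_def)
    show "cnj (azimuthal x) = of_real s / e"
      unfolding w by (simp add: e_def cis_cnj divide_inverse)
  qed
  have "(\<Sum>n\<in>idx l. spin_coeff l a b n * sph_harm l n x) =
      (\<Sum>n\<in>idx l. a ^ nat (int l + n) * b ^ nat (int l - n) *
        of_real (coeff (herglotz_poly l s (x $ 3)) (nat (int l - n))) * e powi n)"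
  proof (rule sum.cong[OF refl])
    fix n assume n: "n \<in> idx l"
    show "spin_coeff l a b n * sph_harm l n x = a ^ nat (int l + n) * b ^ nat (int l - n) *
        of_real (coeff (herglotz_poly l s (x $ 3)) (nat (int l - n))) * e powi n"
      unfolding spin_coeff_def sph_harm_polar s_def spin_norm_polar[OF n S2_height[OF x], symmetric]
      by (simp add: e_def cis_power_int)
  qed
  also have "\<dots> = (\<Sum>k\<le>2*l. e ^ l * (a ^ (2 * l - k) * (b / e) ^ k * of_real (coeff (herglotz_poly l s (x $ 3)) k)))"
    unfolding sum_idx
  proof (rule sum.cong[OF refl])
    fix k assume "k \<in> {..2 * l}"
    then have "nat (int l + (int l - int k)) = 2 * l - k" "nat (int l - (int l - int k)) = k" by auto
    then show "a ^ nat (int l + (int l - int k)) * b ^ nat (int l - (int l - int k)) *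
          of_real (coeff (herglotz_poly l s (x $ 3)) (nat (int l - (int l - int k)))) * e powi (int l - int k) =
        e ^ l * (a ^ (2 * l - k) * (b / e) ^ k * of_real (coeff (herglotz_poly l s (x $ 3)) k))"
      using e0 by (simp add: power_int_diff power_divide)
  qed
  also have "\<dots> = (e * (a\<^sup>2 * of_real s + 2 * a * (b / e) * of_real (x $ 3) - (b / e)\<^sup>2 * of_real s)) ^ l"
    by (simp only: sum_distrib_left[symmetric] herglotz_poly_homogeneous power_mult_distrib)
  also have "e * (a\<^sup>2 * of_real s + 2 * a * (b / e) * of_real (x $ 3) - (b / e)\<^sup>2 * of_real s) =
      a\<^sup>2 * azimuthal x + 2 * a * b * of_real (x $ 3) - b\<^sup>2 * cnj (azimuthal x)"
    unfolding w(2) unfolding w(1) using e0 by (simp add: field_simps power2_eq_square)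
  finally show ?thesis .
qed

subsection \<open>Linear independence of the spherical harmonics\<close>

text \<open>Discrete Fourier orthogonality. The ratio q is an N-th root of unity, the bound on |n -
  m| excludes q = 1 unless n = m, and then the geometric sum vanishes.\<close>

lemma sum_cis_roots_of_unity:
  fixes n m :: int
  assumes "\<bar>n - m\<bar> < int N"
  shows "(\<Sum>k<N. cis (2 * pi * real k / real N) powi n * cis (2 * pi * real k / real N) powi (- m)) =
    (if n = m then of_nat N else 0)"
proof -
  have N: "N > 0" using assms by simp
  define q where "q = cis (2 * pi * of_int (n - m) / real N)"
  have *: "cis (2 * pi * real k / real N) powi n * cis (2 * pi * real k / real N) powi (- m) = q ^ k" for k
    by (simp add: q_def cis_power_int Complex.DeMoivre cis_mult field_simps diff_divide_distrib)
  have qN: "q ^ N = 1"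
    using N cis_multiple_2pi[of "of_int (n - m)"] by (simp add: q_def Complex.DeMoivre del: cis_multiple_2pi)
  show ?thesis
  proof (cases "n = m")
    case True
    then show ?thesis unfolding * by (simp add: q_def)
  next
    case False
    have "q \<noteq> 1"
    proof
      assume "q = 1"
      then have "cos (2 * pi * of_int (n - m) / real N) = 1"
        by (simp add: q_def complex_eq_iff)
      then obtain i :: int where "2 * pi * of_int (n - m) / real N = of_int i * 2 * pi"
        by (auto simp: cos_one_2pi_int)
      then have "2 * pi * of_int (n - m) = 2 * pi * (of_int i * real N)" using N by (simp add: field_simps)
      then have "of_int (n - m) = of_int i * real N" by (simp del: of_int_diff)
      then have eq: "n - m = i * int N"
        by (metis of_int_eq_iff of_int_mult of_int_of_nat_eq)
      then have "i \<noteq> 0" using False by auto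
      then have "1 * int N \<le> \<bar>i\<bar> * int N" by (intro mult_right_mono) auto
      then show False using eq assms by (simp add: abs_mult)
    qed
    then show ?thesis
      unfolding * using False qN by (simp add: geometric_sum)
  qed
qed

text \<open>Sampling at N equidistant angles extracts one Fourier coefficient; N exceeds every |m -
  m0|, so no other frequency is aliased onto m0.\<close>

lemma trig_polynomial_zero:
  fixes c :: "int \<Rightarrow> complex"
  assumes "finite M" and zero: "\<And>t. (\<Sum>m\<in>M. c m * cis t powi m) = 0" and "m0 \<in> M"
  shows "c m0 = 0"
proof -
  define N where "N = Suc (nat (Max ((\<lambda>m. \<bar>m - m0\<bar>) ` M)))"
  have N: "\<bar>m - m0\<bar> < int N" if "m \<in> M" for m
  proof -
    have "\<bar>m - m0\<bar> \<le> Max ((\<lambda>m. \<bar>m - m0\<bar>) ` M)" using that assms(1) by (intro Max_ge) auto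
    then show ?thesis unfolding N_def by linarith
  qed
  let ?t = "\<lambda>k. cis (2 * pi * real k / real N)"
  have "0 = (\<Sum>k<N. (\<Sum>m\<in>M. c m * ?t k powi m) * ?t k powi (- m0))"
    unfolding zero by simp
  also have "\<dots> = (\<Sum>m\<in>M. c m * (\<Sum>k<N. ?t k powi m * ?t k powi (- m0)))"
    unfolding sum_distrib_right sum_distrib_left by (subst sum.swap) (simp only: mult.assoc)
  also have "\<dots> = (\<Sum>m\<in>M. if m = m0 then c m * of_nat N else 0)"
    by (intro sum.cong refl) (simp only: sum_cis_roots_of_unity[OF N], simp)
  also have "\<dots> = c m0 * of_nat N" using assms by simp
  finally have "c m0 * of_nat N = 0" by simp
  moreover have "N \<noteq> 0" by (simp add: N_def)
  ultimately show ?thesis by simp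
qed

text \<open>Among the terms with nonzero coefficient one has strictly largest degree, and its
  leading coefficient cannot be cancelled.\<close>

lemma independent_polys_distinct_degrees:
  fixes p :: "nat \<Rightarrow> 'a::idom poly"
  assumes "finite A" "inj_on (\<lambda>j. degree (p j)) A" and nz: "\<And>j. j \<in> A \<Longrightarrow> p j \<noteq> 0"
    and sum0: "(\<Sum>j\<in>A. smult (c j) (p j)) = 0" and "j \<in> A"
  shows "c j = 0"
proof (rule ccontr)
  assume cj: "c j \<noteq> 0"
  define B where "B = {j \<in> A. c j \<noteq> 0}"
  have B: "finite B" "B \<noteq> {}" using assms cj by (auto simp: B_def)
  have "Max ((\<lambda>j. degree (p j)) ` B) \<in> (\<lambda>j. degree (p j)) ` B" using B by (intro Max_in) auto
  then obtain i where i: "i \<in> B" "degree (p i) = Max ((\<lambda>j. degree (p j)) ` B)" by auto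
  have imax: "degree (p k) \<le> degree (p i)" if "k \<in> B" for k
    unfolding i(2) using B that by (intro Max_ge) auto
  have iA: "i \<in> A" "c i \<noteq> 0" using i(1) by (auto simp: B_def)
  have "0 = coeff (\<Sum>j\<in>A. smult (c j) (p j)) (degree (p i))" by (simp add: sum0)
  also have "\<dots> = (\<Sum>k\<in>A. if k = i then c i * lead_coeff (p i) else 0)"
    unfolding coeff_sum
  proof (rule sum.cong[OF refl])
    fix k assume k: "k \<in> A"
    show "coeff (smult (c k) (p k)) (degree (p i)) = (if k = i then c i * lead_coeff (p i) else 0)"
    proof (cases "k = i \<or> c k = 0")
      case False
      then have "degree (p k) \<noteq> degree (p i)" "k \<in> B"
        using assms(2) k iA by (auto simp: inj_on_def B_def)
      then have "degree (p k) < degree (p i)" using imax le_neq_implies_less by blast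
      then show ?thesis using False by (simp add: coeff_eq_0)
    qed (use iA in auto)
  qed
  also have "\<dots> = c i * lead_coeff (p i)" using iA assms(1) by simp
  finally show False using iA nz by simp
qed

lemma poly_map_poly_of_real: "poly (map_poly complex_of_real p) (of_real z) = of_real (poly p z)"
  by (induction p) (simp_all add: map_poly_pCons)

lemma degree_legendre_poly: "degree (legendre_poly l) = l"
proof -
  have "degree ([:-1, 0, 1::real:] ^ l) = 2 * l"
    by (subst degree_power_eq) auto
  then show ?thesis by (simp add: legendre_poly_def degree_higher_pderiv)
qed

lemma higher_pderiv_legendre_poly_nonzero:
  assumes "m \<le> l"
  shows "(pderiv ^^ m) (legendre_poly l) \<noteq> 0"
proof (cases "l = 0")
  case True
  then show ?thesis using assms by (simp add: legendre_poly_def)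
next
  case False
  then have lc: "coeff (legendre_poly l) l \<noteq> 0"
    using leading_coeff_neq_0[of "legendre_poly l"] degree_legendre_poly[of l] by fastforce
  have "coeff ((pderiv ^^ m) (legendre_poly l)) (l - m) =
      pochhammer (real (Suc (l - m))) m * coeff (legendre_poly l) l"
    using assms by (simp add: coeff_higher_pderiv)
  then have "coeff ((pderiv ^^ m) (legendre_poly l)) (l - m) \<noteq> 0"
    using lc by (simp add: pochhammer_eq_0_iff)
  then show ?thesis by (metis coeff_0)
qed

text \<open>Separation of variables. On a circle of latitude, Fourier analysis in the azimuth
  isolates the order m0. What remains are, up to nonzero constants and the common factor
  \<open>sqrt (1 - z\<^sup>2) ^ \<mu>\<close>, the \<mu>-th derivatives of Legendre polynomials,
  whose degrees j - \<mu> are distinct.\<close>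

lemma sph_harm_independent:
  assumes A: "finite A"
    and zero: "\<And>x. x \<in> S2 \<Longrightarrow> (\<Sum>j\<in>A. \<Sum>m\<in>idx j. d j m * sph_harm j m x) = 0"
    and j0: "j0 \<in> A" and m0: "m0 \<in> idx j0"
  shows "d j0 m0 = 0"
proof -
  define A' where "A' = {j \<in> A. m0 \<in> idx j}"
  define M where "M = (\<Union>j\<in>A. idx j)"
  have fin: "finite A'" "finite M" using A by (auto simp: A'_def M_def)
  \<comment> \<open>The poles are excluded so that s > 0: the azimuth is then free, and the power of
    s can later be divided out.\<close>
  have polar: "(\<Sum>j\<in>A'. d j m0 * of_real (sph_polar j m0 z)) = 0" if z: "z \<in> {-1<..<1}" for z
  proof -
    define s where "s = sqrt (1 - z\<^sup>2)"
    have zz: "z\<^sup>2 < 1" using z by (simp add: abs_square_less_1 abs_less_iff)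
    then have s: "s > 0" "s\<^sup>2 = 1 - z\<^sup>2" by (simp_all add: s_def)
    have "(\<Sum>m\<in>M. (\<Sum>j\<in>{j\<in>A. m \<in> idx j}. d j m * of_real (sph_polar j m z)) * cis t powi m) = 0" for t
    proof -
      define x :: "real ^ 3" where "x = vector [s * cos t, s * sin t, z]"
      have x: "azimuthal x = of_real s * cis t" "x $ 3 = z"
        by (simp_all add: x_def azimuthal_def complex_eq_iff)
      have "(s * cos t)\<^sup>2 + (s * sin t)\<^sup>2 = s\<^sup>2 * ((cos t)\<^sup>2 + (sin t)\<^sup>2)"
        by (simp only: power_mult_distrib distrib_left)
      then have "x \<in> S2" unfolding S2_coords by (simp add: x_def s)
      have "sgn (azimuthal x) = cis t"
        using s by (simp add: x sgn_mult sgn_of_real)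
      moreover have "azimuthal x \<noteq> 0" using s by (simp add: x)
      ultimately have arg: "cis (Arg (azimuthal x)) = cis t" by (simp add: cis_Arg)
      have Y: "sph_harm j m x = of_real (sph_polar j m z) * cis t powi m" for j m
        unfolding sph_harm_polar cis_power_int[symmetric] arg x(2) ..
      have "0 = (\<Sum>j\<in>A. \<Sum>m\<in>idx j. d j m * sph_harm j m x)" using zero[OF \<open>x \<in> S2\<close>] by simp
      also have "\<dots> = (\<Sum>j\<in>A. \<Sum>m\<in>{m\<in>M. m \<in> idx j}. d j m * of_real (sph_polar j m z) * cis t powi m)"
        unfolding Y mult.assoc by (intro sum.cong refl) (auto simp: M_def)
      also have "\<dots> = (\<Sum>m\<in>M. \<Sum>j\<in>{j\<in>A. m \<in> idx j}. d j m * of_real (sph_polar j m z) * cis t powi m)"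
        by (rule sum.swap_restrict[OF A fin(2)])
      finally show ?thesis by (simp add: sum_distrib_right)
    qed
    moreover have "m0 \<in> M" using j0 m0 by (auto simp: M_def)
    ultimately show ?thesis unfolding A'_def using trig_polynomial_zero[OF fin(2)] by fastforce
  qed
  define \<mu> where "\<mu> = nat \<bar>m0\<bar>"
  define \<nu> where "\<nu> j = (if m0 \<ge> 0 then 1 else (-1) ^ nat (- m0)) *
     sqrt ((2 * real j + 1) * fact (j - \<mu>) / fact (j + \<mu>)) * (-1) ^ \<mu>" for j
  have \<nu>0: "\<nu> j \<noteq> 0" for j by (simp add: \<nu>_def)
  define p where "p j = map_poly complex_of_real ((pderiv ^^ \<mu>) (legendre_poly j))" for j
  have \<mu>: "\<mu> \<le> j" if "j \<in> A'" for j using that by (auto simp: A'_def idx_def \<mu>_def)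
  have sp: "sph_polar j m0 z = \<nu> j * sqrt (1 - z\<^sup>2) ^ \<mu> * poly ((pderiv ^^ \<mu>) (legendre_poly j)) z" for j z
    by (simp add: sph_polar_def assoc_legendre_def \<nu>_def \<mu>_def)
  have "(\<Sum>j\<in>A'. smult (d j m0 * of_real (\<nu> j)) (p j)) = 0" (is "?P = 0")
  proof (rule ccontr)
    assume "?P \<noteq> 0"
    then have "finite {u. poly ?P u = 0}" by (rule poly_roots_finite)
    moreover have "complex_of_real ` {-1<..<1} \<subseteq> {u. poly ?P u = 0}"
    proof clarify
      fix z :: real assume z: "z \<in> {-1<..<1}"
      have "z\<^sup>2 < 1" using z by (simp add: abs_square_less_1 abs_less_iff)
      then have s: "sqrt (1 - z\<^sup>2) \<noteq> 0" by simp
      have "of_real (sqrt (1 - z\<^sup>2) ^ \<mu>) * poly ?P (of_real z) = (\<Sum>j\<in>A'. d j m0 * of_real (sph_polar j m0 z))"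
        unfolding sp poly_sum sum_distrib_left p_def poly_smult
        by (intro sum.cong refl) (simp add: mult_ac poly_map_poly_of_real)
      then show "poly ?P (of_real z) = 0" using polar[OF z] s by simp
    qed
    ultimately have "finite (complex_of_real ` {-1<..<1})" using finite_subset by blast
    then have "finite {-1<..<1::real}" by (rule finite_imageD) (simp add: inj_on_def)
    then show False using infinite_Ioo[of "-1" "1::real"] by simp
  qed
  moreover have "degree (p j) = j - \<mu>" for j
    by (simp add: p_def degree_map_poly degree_higher_pderiv degree_legendre_poly)
  then have "inj_on (\<lambda>j. degree (p j)) A'" using \<mu> by (auto simp: inj_on_def) (metis le_add_diff_inverse)
  moreover have "p j \<noteq> 0" if "j \<in> A'" for j
    using higher_pderiv_legendre_poly_nonzero[OF \<mu>[OF that]] by (simp add: p_def map_poly_eq_0_iff)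
  moreover have "j0 \<in> A'" using j0 m0 by (simp add: A'_def)
  ultimately have "d j0 m0 * of_real (\<nu> j0) = 0"
    using independent_polys_distinct_degrees[OF fin(1), of p "\<lambda>j. d j m0 * of_real (\<nu> j)" j0] by blast
  then show ?thesis using \<nu>0 by simp
qed

text \<open>The uniqueness half of the definite description \<open>wigner_D\<close>, and the tool
  for identifying its entries.\<close>

corollary sph_harm_coeffs_unique:
  assumes "\<And>x. x \<in> S2 \<Longrightarrow> (\<Sum>n\<in>idx l. c n * sph_harm l n x) = (\<Sum>n\<in>idx l. d n * sph_harm l n x)"
    and "n \<in> idx l"
  shows "c n = d n"
  using sph_harm_independent[of "{l}" "\<lambda>_ n. c n - d n" l n] assms
  by (simp add: left_diff_distrib sum_subtractf)

subsection \<open>Isotropic vectors and unitarity of the Wigner matrices\<close>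

text \<open>Bilinear, without conjugation: this is the form with nonzero isotropic vectors. The
  hermitian product is recovered through \<open>cvec_cnj\<close>, which commutes with real
  matrices.\<close>

definition bdot :: "complex ^ 3 \<Rightarrow> complex ^ 3 \<Rightarrow> complex" where
  "bdot u v = (\<Sum>i\<in>UNIV. u $ i * v $ i)"

definition cvec :: "real ^ 3 \<Rightarrow> complex ^ 3" where
  "cvec x = (\<chi> i. of_real (x $ i))"

definition cvec_cnj :: "complex ^ 3 \<Rightarrow> complex ^ 3" where
  "cvec_cnj u = (\<chi> i. cnj (u $ i))"

definition cmat_vec :: "real ^ 3 ^ 3 \<Rightarrow> complex ^ 3 \<Rightarrow> complex ^ 3" where
  "cmat_vec g u = (\<chi> i. \<Sum>j\<in>UNIV. of_real (g $ i $ j) * u $ j)"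

lemma cmat_vec_cnj: "cmat_vec g (cvec_cnj u) = cvec_cnj (cmat_vec g u)"
  by (simp add: cmat_vec_def cvec_cnj_def)

lemma bdot_cmat_vec_cvec: "bdot (cmat_vec g u) (cvec x) = bdot u (cvec (transpose g *v x))"
proof -
  have "bdot (cmat_vec g u) (cvec x) = (\<Sum>i\<in>UNIV. \<Sum>j\<in>UNIV. u $ j * (of_real (g $ i $ j) * of_real (x $ i)))"
    by (simp add: bdot_def cmat_vec_def cvec_def sum_distrib_left sum_distrib_right mult_ac)
  also have "\<dots> = (\<Sum>j\<in>UNIV. \<Sum>i\<in>UNIV. u $ j * (of_real (g $ i $ j) * of_real (x $ i)))"
    by (rule sum.swap)
  also have "\<dots> = bdot u (cvec (transpose g *v x))"
    by (simp add: bdot_def cvec_def transpose_def matrix_vector_mult_def sum_distrib_left)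
  finally show ?thesis .
qed

lemma bdot_orthogonal:
  assumes "orthogonal_matrix g"
  shows "bdot (cmat_vec g u) (cmat_vec g v) = bdot u v"
proof -
  have "transpose g ** g = mat 1" using assms by (simp add: orthogonal_matrix)
  then have g: "(\<Sum>i\<in>UNIV. g $ i $ j * g $ i $ k) = (if j = k then 1 else 0)" for j k
    by (simp add: vec_eq_iff matrix_matrix_mult_def transpose_def mat_def)
  have "bdot (cmat_vec g u) (cmat_vec g v) =
      (\<Sum>i\<in>UNIV. \<Sum>j\<in>UNIV. \<Sum>k\<in>UNIV. u $ j * v $ k * of_real (g $ i $ j * g $ i $ k))"
    by (simp add: bdot_def cmat_vec_def sum_product mult_ac)
  also have "\<dots> = (\<Sum>j\<in>UNIV. \<Sum>i\<in>UNIV. \<Sum>k\<in>UNIV. u $ j * v $ k * of_real (g $ i $ j * g $ i $ k))"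
    by (rule sum.swap)
  also have "\<dots> = (\<Sum>j\<in>UNIV. \<Sum>k\<in>UNIV. \<Sum>i\<in>UNIV. u $ j * v $ k * of_real (g $ i $ j * g $ i $ k))"
    by (intro sum.cong refl sum.swap)
  also have "\<dots> = (\<Sum>j\<in>UNIV. \<Sum>k\<in>UNIV. u $ j * v $ k * of_real (if j = k then 1 else 0))"
    by (simp only: g[symmetric] of_real_sum sum_distrib_left)
  also have "\<dots> = (\<Sum>j\<in>UNIV. \<Sum>k\<in>UNIV. if k = j then u $ j * v $ j else 0)"
    by (intro sum.cong refl) auto
  also have "\<dots> = bdot u v" by (simp add: bdot_def)
  finally show ?thesis .
qed

lemma matrix_inv_orthogonal:
  fixes g :: "real ^ 'n ^ 'n"
  assumes "orthogonal_matrix g"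
  shows "matrix_inv g = transpose g"
proof -
  have g: "g ** transpose g = mat 1" "transpose g ** g = mat 1"
    using assms by (simp_all add: orthogonal_matrix_def)
  then have "g ** matrix_inv g = mat 1 \<and> matrix_inv g ** g = mat 1"
    unfolding matrix_inv_def
    by (intro someI[of "\<lambda>A. g ** A = mat 1 \<and> A ** g = mat 1" "transpose g"] conjI)
  then show ?thesis using g by (metis matrix_mul_assoc matrix_mul_lid matrix_mul_rid)
qed

lemma orthogonal_matrix_S2:
  assumes "orthogonal_matrix g" "x \<in> S2"
  shows "g *v x \<in> S2"
  using assms orthogonal_transformation_norm[of "(*v) g" x]
  by (simp add: orthogonal_transformation_matrix)

text \<open>Cartan's parametrization of the null cone of \<open>bdot\<close> by C^2, two-to-one away
  from 0.\<close>

definition spinor :: "complex \<Rightarrow> complex \<Rightarrow> complex ^ 3" where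
  "spinor a b = vector [a\<^sup>2 - b\<^sup>2, \<i> * (a\<^sup>2 + b\<^sup>2), 2 * a * b]"

lemma bdot_spinor_cvec:
  "bdot (spinor a b) (cvec x) = a\<^sup>2 * azimuthal x + 2 * a * b * of_real (x $ 3) - b\<^sup>2 * cnj (azimuthal x)"
  by (simp add: bdot_def spinor_def cvec_def azimuthal_def sum_3 Complex_eq algebra_simps)

lemma bdot_spinor_self: "bdot (spinor a b) (spinor a b) = 0"
  by (simp add: bdot_def spinor_def sum_3 power2_eq_square algebra_simps)

lemma bdot_spinor_cnj:
  "bdot (spinor a b) (cvec_cnj (spinor a' b')) = 2 * (a * cnj a' + b * cnj b')\<^sup>2"
  by (simp add: bdot_def spinor_def cvec_cnj_def sum_3 power2_eq_square algebra_simps)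

text \<open>The first two coordinates determine a^2 and b^2. Isotropy then fixes 2 a b up to sign,
  and the sign is repaired by replacing b with -b.\<close>

lemma isotropic_spinor:
  assumes "bdot u u = 0"
  obtains a b where "u = spinor a b"
proof -
  define a where "a = csqrt ((u $ 1 - \<i> * u $ 2) / 2)"
  define b where "b = csqrt (- (u $ 1 + \<i> * u $ 2) / 2)"
  have a2: "a\<^sup>2 = (u $ 1 - \<i> * u $ 2) / 2" and b2: "b\<^sup>2 = - (u $ 1 + \<i> * u $ 2) / 2"
    by (simp_all add: a_def b_def)
  have "(2 * a * b)\<^sup>2 = 4 * a\<^sup>2 * b\<^sup>2" by (simp add: power_mult_distrib)
  also have "\<dots> = - (u $ 1 * u $ 1 + u $ 2 * u $ 2)"
    unfolding a2 b2 by (simp add: field_simps)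
  also have "\<dots> = (u $ 3)\<^sup>2"
    using assms by (simp add: bdot_def sum_3 power2_eq_square neg_eq_iff_add_eq_0 del: minus_add_distrib)
  finally consider "2 * a * b = u $ 3" | "2 * a * (- b) = u $ 3"
    by (auto simp: power2_eq_iff)
  then obtain b' where b': "2 * a * b' = u $ 3" "b'\<^sup>2 = b\<^sup>2" by (metis power2_minus)
  have "u $ 1 = a\<^sup>2 - b'\<^sup>2" "u $ 2 = \<i> * (a\<^sup>2 + b'\<^sup>2)"
    unfolding b'(2) a2 b2 by (simp_all add: field_simps)
  then have "u = spinor a b'"
    using b'(1) by (simp add: vec_eq_iff forall_3 spinor_def)
  then show ?thesis by (rule that)
qed

text \<open>With k = l - n the squares of \<open>spin_norm\<close> are the binomial coefficients of
  2l times their value at n = l, which is the constant; the sum is then the binomial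
  theorem.\<close>

lemma spin_coeff_gram:
  "(\<Sum>n\<in>idx l. spin_coeff l a b n * cnj (spin_coeff l a' b' n)) =
    of_real ((2 ^ l * fact l)\<^sup>2 / ((2 * real l + 1) * fact (2 * l))) * (a * cnj a' + b * cnj b') ^ (2 * l)"
proof -
  let ?\<kappa> = "(2 ^ l * fact l)\<^sup>2 / ((2 * real l + 1) * fact (2 * l))"
  have "(\<Sum>n\<in>idx l. spin_coeff l a b n * cnj (spin_coeff l a' b' n)) =
     (\<Sum>k\<le>2*l. of_real ?\<kappa> * (of_nat (2 * l choose k) * (b * cnj b') ^ k * (a * cnj a') ^ (2 * l - k)))"
    unfolding sum_idx
  proof (rule sum.cong[OF refl])
    fix k assume k: "k \<in> {..2 * l}"
    define n where "n = int l - int k"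
    have n: "nat (int l + n) = 2 * l - k" "nat (int l - n) = k" using k by (auto simp: n_def)
    have sgn: "(-1::real) ^ nat \<bar>n\<bar> * (-1) ^ nat \<bar>n\<bar> = 1" by (simp flip: power_mult_distrib)
    have "spin_norm l n * spin_norm l n = (2 ^ l * fact l)\<^sup>2 / ((2 * real l + 1) * fact (2 * l - k) * fact k)"
      unfolding spin_norm_def n using sgn
      by (simp add: power2_eq_square field_simps flip: real_sqrt_mult)
    also have "\<dots> = ?\<kappa> * real (2 * l choose k)"
    proof -
      have "real (2 * l choose k) = fact (2 * l) / (fact k * fact (2 * l - k))"
        using k by (intro binomial_fact) simp
      then show ?thesis by (simp add: mult_ac)
    qed
    finally have c: "spin_norm l n * spin_norm l n = ?\<kappa> * real (2 * l choose k)" .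
    have "spin_coeff l a b n * cnj (spin_coeff l a' b' n) =
        of_real (spin_norm l n * spin_norm l n) * ((b * cnj b') ^ k * (a * cnj a') ^ (2 * l - k))"
      unfolding spin_coeff_def n by (simp add: power_mult_distrib mult_ac)
    also have "\<dots> = of_real ?\<kappa> * (of_nat (2 * l choose k) * (b * cnj b') ^ k * (a * cnj a') ^ (2 * l - k))"
      unfolding c by (simp add: mult_ac)
    finally show "spin_coeff l a b (int l - int k) * cnj (spin_coeff l a' b' (int l - int k)) =
       of_real ?\<kappa> * (of_nat (2 * l choose k) * (b * cnj b') ^ k * (a * cnj a') ^ (2 * l - k))"
      by (simp only: n_def)
  qed
  also have "\<dots> = of_real ?\<kappa> * (b * cnj b' + a * cnj a') ^ (2 * l)"
    by (simp only: binomial_ring sum_distrib_left)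
  finally show ?thesis by (simp only: add.commute)
qed

text \<open>The power 2l is the l-th power of a square that depends only on the two isotropic
  vectors. In this form the Gram matrix is visibly rotation invariant and blind to the signs of the
  spinors.\<close>

lemma spin_coeff_gram_bdot:
  "(\<Sum>n\<in>idx l. spin_coeff l a b n * cnj (spin_coeff l a' b' n)) =
    of_real ((2 ^ l * fact l)\<^sup>2 / ((2 * real l + 1) * fact (2 * l))) *
      (bdot (spinor a b) (cvec_cnj (spinor a' b')) / 2) ^ l"
  unfolding spin_coeff_gram bdot_spinor_cnj by (simp add: power_mult)

section \<open>Construction of the Wigner matrices\<close>

lemma spin_norm_nonzero [simp]: "spin_norm l n \<noteq> 0"
  by (simp add: spin_norm_def)

text \<open>For a = 1 the entries are, up to \<open>spin_norm\<close>, the powers of b with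
  exponents 0 to 2l. Taking for b the (2l+1)-th roots of unity gives an invertible Fourier matrix,
  and \<beta> is its rescaled inverse.\<close>

lemma spin_coeff_dual:
  "\<exists>(N :: nat) t \<beta>. \<forall>n\<in>idx l. \<forall>n'\<in>idx l.
    (\<Sum>k<N. \<beta> n k * spin_coeff l 1 (t k) n') = (if n = n' then 1 else 0)"
proof -
  define N where "N = 2 * l + 1"
  define t where "t k = cis (2 * pi * real k / real N)" for k :: nat
  define \<beta> where "\<beta> n k = t k powi (- (int l - n)) / (of_nat N * of_real (spin_norm l n))" for n and k :: nat
  show ?thesis
  proof (intro exI ballI)
    fix n n' assume n: "n \<in> idx l" and n': "n' \<in> idx l"
    have "int (nat (int l - n')) = int l - n'"
      using n' by (auto simp: idx_def)
    then have pw: "t k ^ nat (int l - n') = t k powi (int l - n')" for k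
      by (metis power_int_of_nat)
    have "(\<Sum>k<N. \<beta> n k * spin_coeff l 1 (t k) n') =
        (\<Sum>k<N. t k powi (int l - n') * t k powi (- (int l - n))) * of_real (spin_norm l n') / (of_nat N * of_real (spin_norm l n))"
      by (simp add: \<beta>_def spin_coeff_def pw sum_distrib_left sum_divide_distrib mult_ac)
    also have "(\<Sum>k<N. t k powi (int l - n') * t k powi (- (int l - n))) = (if int l - n' = int l - n then of_nat N else 0)"
      unfolding t_def using n n' by (intro sum_cis_roots_of_unity) (auto simp: idx_def N_def)
    finally show "(\<Sum>k<N. \<beta> n k * spin_coeff l 1 (t k) n') = (if n = n' then 1 else 0)"
      by (auto simp: N_def simp del: of_nat_Suc of_nat_add)
  qed
qed

lemma wigner_matrix_exists:
  assumes g: "orthogonal_matrix g"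
  obtains D where "\<And>n' n. n' \<notin> idx l \<or> n \<notin> idx l \<Longrightarrow> D n' n = 0"
    and "\<And>n x. n \<in> idx l \<Longrightarrow> x \<in> S2 \<Longrightarrow>
      sph_harm l n (matrix_inv g *v x) = (\<Sum>n'\<in>idx l. D n' n * sph_harm l n' x)"
    and "\<And>n m. n \<in> idx l \<Longrightarrow> m \<in> idx l \<Longrightarrow>
      (\<Sum>n'\<in>idx l. D n' n * cnj (D n' m)) = (if n = m then 1 else 0)"
proof -
  obtain N :: nat and t \<beta> where dual: "\<And>n n'. n \<in> idx l \<Longrightarrow> n' \<in> idx l \<Longrightarrow>
      (\<Sum>k<N. \<beta> n k * spin_coeff l 1 (t k) n') = (if n = n' then 1 else 0)"
    using spin_coeff_dual[of l] by blast
  have "\<exists>a b. cmat_vec g (spinor 1 (t k)) = spinor a b" for k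
  proof -
    have "bdot (cmat_vec g (spinor 1 (t k))) (cmat_vec g (spinor 1 (t k))) = 0"
      using g by (simp add: bdot_orthogonal bdot_spinor_self)
    then show ?thesis by (metis isotropic_spinor)
  qed
  then obtain a b where ab: "\<And>k. cmat_vec g (spinor 1 (t k)) = spinor (a k) (b k)" by metis
  \<comment> \<open>Y_l^n is the \<beta>-combination of the sampled generating functions. Rotation
    replaces the spinor (1, t k) of a sample by (a k, b k), and D collects the resulting
    coefficients.\<close>
  define D where "D n' n = (if n' \<in> idx l \<and> n \<in> idx l
      then \<Sum>k<N. \<beta> n k * spin_coeff l (a k) (b k) n' else 0)" for n' n
  have expand: "(\<Sum>k<N. \<beta> n k * (\<Sum>n'\<in>idx l. spin_coeff l 1 (t k) n' * F n')) = F n" if "n \<in> idx l" for n F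
  proof -
    have "(\<Sum>k<N. \<beta> n k * (\<Sum>n'\<in>idx l. spin_coeff l 1 (t k) n' * F n')) =
        (\<Sum>n'\<in>idx l. (\<Sum>k<N. \<beta> n k * spin_coeff l 1 (t k) n') * F n')"
      unfolding sum_distrib_left sum_distrib_right by (subst sum.swap) (simp only: mult.assoc)
    also have "\<dots> = (\<Sum>n'\<in>idx l. if n' = n then F n' else 0)"
      using that by (intro sum.cong refl) (auto simp: dual)
    also have "\<dots> = F n" using that by simp
    finally show ?thesis .
  qed
  show ?thesis
  proof (rule that)
    show "D n' n = 0" if "n' \<notin> idx l \<or> n \<notin> idx l" for n' n
      using that by (auto simp: D_def)
  next
    fix n x assume n: "n \<in> idx l" and x: "x \<in> S2"
    have gx: "transpose g *v x \<in> S2"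
      using g x by (intro orthogonal_matrix_S2) auto
    have gen: "(\<Sum>n'\<in>idx l. spin_coeff l 1 (t k) n' * sph_harm l n' (transpose g *v x)) =
        (\<Sum>n'\<in>idx l. spin_coeff l (a k) (b k) n' * sph_harm l n' x)" for k
      unfolding sph_harm_generating_function[OF x] sph_harm_generating_function[OF gx]
        bdot_spinor_cvec[symmetric] ab[symmetric] bdot_cmat_vec_cvec ..
    have "sph_harm l n (transpose g *v x) =
        (\<Sum>k<N. \<beta> n k * (\<Sum>n'\<in>idx l. spin_coeff l (a k) (b k) n' * sph_harm l n' x))"
      unfolding gen[symmetric] expand[OF n] ..
    also have "\<dots> = (\<Sum>n'\<in>idx l. D n' n * sph_harm l n' x)"
      unfolding sum_distrib_left using n
      by (subst sum.swap) (simp add: D_def sum_distrib_right mult.assoc)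
    finally show "sph_harm l n (matrix_inv g *v x) = (\<Sum>n'\<in>idx l. D n' n * sph_harm l n' x)"
      by (simp add: matrix_inv_orthogonal[OF g])
  next
    fix n m assume n: "n \<in> idx l" and m: "m \<in> idx l"
    \<comment> \<open>Invariance of the Gram matrix lets the original samples replace the rotated
      ones; the duality of \<beta> then collapses both sums over samples.\<close>
    have gram: "(\<Sum>n'\<in>idx l. spin_coeff l (a k) (b k) n' * cnj (spin_coeff l (a k') (b k') n')) =
        (\<Sum>n'\<in>idx l. spin_coeff l 1 (t k) n' * cnj (spin_coeff l 1 (t k') n'))" for k k'
      unfolding spin_coeff_gram_bdot ab[symmetric] cmat_vec_cnj[symmetric] bdot_orthogonal[OF g] ..
    have "(\<Sum>n'\<in>idx l. D n' n * cnj (D n' m)) =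
        (\<Sum>n'\<in>idx l. \<Sum>k<N. \<Sum>k'<N. \<beta> n k * cnj (\<beta> m k') * (spin_coeff l (a k) (b k) n' * cnj (spin_coeff l (a k') (b k') n')))"
      using n m by (intro sum.cong refl) (simp add: D_def sum_product mult_ac)
    also have "\<dots> = (\<Sum>k<N. \<Sum>n'\<in>idx l. \<Sum>k'<N. \<beta> n k * cnj (\<beta> m k') * (spin_coeff l (a k) (b k) n' * cnj (spin_coeff l (a k') (b k') n')))"
      by (rule sum.swap)
    also have "\<dots> = (\<Sum>k<N. \<Sum>k'<N. \<Sum>n'\<in>idx l. \<beta> n k * cnj (\<beta> m k') * (spin_coeff l (a k) (b k) n' * cnj (spin_coeff l (a k') (b k') n')))"
      by (intro sum.cong refl sum.swap)
    also have "\<dots> = (\<Sum>k<N. \<Sum>k'<N. \<Sum>n'\<in>idx l. \<beta> n k * cnj (\<beta> m k') * (spin_coeff l 1 (t k) n' * cnj (spin_coeff l 1 (t k') n')))"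
      by (simp only: sum_distrib_left[symmetric] gram)
    also have "\<dots> = (\<Sum>k<N. \<beta> n k * (\<Sum>n'\<in>idx l. spin_coeff l 1 (t k) n' * (\<Sum>k'<N. cnj (\<beta> m k' * spin_coeff l 1 (t k') n'))))"
      unfolding sum_distrib_left
      by (rule sum.cong[OF refl], subst sum.swap) (simp add: mult_ac)
    also have "\<dots> = (\<Sum>k'<N. cnj (\<beta> m k' * spin_coeff l 1 (t k') n))"
      by (rule expand[OF n])
    also have "\<dots> = cnj (\<Sum>k'<N. \<beta> m k' * spin_coeff l 1 (t k') n)" by simp
    also have "\<dots> = (if n = m then 1 else 0)" using n m by (auto simp: dual)
    finally show "(\<Sum>n'\<in>idx l. D n' n * cnj (D n' m)) = (if n = m then 1 else 0)" .
  qed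
qed

lemma
  assumes g: "orthogonal_matrix g"
  shows wigner_D_outside: "n' \<notin> idx l \<or> n \<notin> idx l \<Longrightarrow> wigner_D l g n' n = 0"
    and sph_harm_rotate: "n \<in> idx l \<Longrightarrow> x \<in> S2 \<Longrightarrow>
      sph_harm l n (matrix_inv g *v x) = (\<Sum>n'\<in>idx l. wigner_D l g n' n * sph_harm l n' x)"
    and wigner_D_unitary: "n \<in> idx l \<Longrightarrow> m \<in> idx l \<Longrightarrow>
      (\<Sum>n'\<in>idx l. wigner_D l g n' n * cnj (wigner_D l g n' m)) = (if n = m then 1 else 0)"
proof -
  obtain D where D: "\<And>n' n. n' \<notin> idx l \<or> n \<notin> idx l \<Longrightarrow> D n' n = 0"
    "\<And>n x. n \<in> idx l \<Longrightarrow> x \<in> S2 \<Longrightarrow>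
      sph_harm l n (matrix_inv g *v x) = (\<Sum>n'\<in>idx l. D n' n * sph_harm l n' x)"
    "\<And>n m. n \<in> idx l \<Longrightarrow> m \<in> idx l \<Longrightarrow>
      (\<Sum>n'\<in>idx l. D n' n * cnj (D n' m)) = (if n = m then 1 else 0)"
    using wigner_matrix_exists[OF g] by blast
  have "wigner_D l g = D"
    unfolding wigner_D_def
  proof (rule the_equality)
    fix D' :: "int \<Rightarrow> int \<Rightarrow> complex"
    assume D': "(\<forall>n' n. n' \<notin> idx l \<or> n \<notin> idx l \<longrightarrow> D' n' n = 0) \<and>
      (\<forall>n\<in>idx l. \<forall>x\<in>S2. sph_harm l n (matrix_inv g *v x) = (\<Sum>n'\<in>idx l. D' n' n * sph_harm l n' x))"
    have "D' n' n = D n' n" for n' n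
    proof (cases "n' \<in> idx l \<and> n \<in> idx l")
      case True
      then show ?thesis using D(2)[of n] D'
        by (intro sph_harm_coeffs_unique[where c = "\<lambda>n'. D' n' n" and d = "\<lambda>n'. D n' n"]) auto
    qed (use D(1) D' in auto)
    then show "D' = D" by (intro ext)
  qed (use D in auto)
  then show "n' \<notin> idx l \<or> n \<notin> idx l \<Longrightarrow> wigner_D l g n' n = 0"
    "n \<in> idx l \<Longrightarrow> x \<in> S2 \<Longrightarrow>
      sph_harm l n (matrix_inv g *v x) = (\<Sum>n'\<in>idx l. wigner_D l g n' n * sph_harm l n' x)"
    "n \<in> idx l \<Longrightarrow> m \<in> idx l \<Longrightarrow>
      (\<Sum>n'\<in>idx l. wigner_D l g n' n * cnj (wigner_D l g n' m)) = (if n = m then 1 else 0)"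
    using D by auto
qed

lemma wigner_D_eqI:
  assumes "orthogonal_matrix g" "n \<in> idx l" "n' \<in> idx l"
    and "\<And>x. x \<in> S2 \<Longrightarrow> sph_harm l n (matrix_inv g *v x) = (\<Sum>n'\<in>idx l. c n' * sph_harm l n' x)"
  shows "wigner_D l g n' n = c n'"
  using assms(3) sph_harm_rotate[OF assms(1,2)] assms(4)
  by (intro sph_harm_coeffs_unique[where c = "\<lambda>n'. wigner_D l g n' n" and l = l]) auto

text \<open>In Y_l^n(x) = Y_l^n(g^(-1) (g x)) the right side is expanded first for g at the point g
  x, then for the transpose at x; comparing coefficients in the Y_l^m gives the inverse.\<close>

lemma wigner_D_transpose_mult:
  assumes g: "orthogonal_matrix g" and n: "n \<in> idx l" and m: "m \<in> idx l"
  shows "(\<Sum>k\<in>idx l. wigner_D l (transpose g) m k * wigner_D l g k n) = (if m = n then 1 else 0)"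
proof -
  have g': "orthogonal_matrix (transpose g)" using g by simp
  have "(\<Sum>m\<in>idx l. (\<Sum>k\<in>idx l. wigner_D l (transpose g) m k * wigner_D l g k n) * sph_harm l m x) =
      (\<Sum>m\<in>idx l. (if m = n then 1 else 0) * sph_harm l m x)" if x: "x \<in> S2" for x
  proof -
    have gx: "g *v x \<in> S2" using g x by (rule orthogonal_matrix_S2)
    have "(\<Sum>m\<in>idx l. (if m = n then 1 else 0) * sph_harm l m x) =
        (\<Sum>m\<in>idx l. if m = n then sph_harm l m x else 0)" by (intro sum.cong) auto
    also have "\<dots> = sph_harm l n x" using n by simp
    also have "\<dots> = sph_harm l n (matrix_inv g *v (g *v x))"
      using g by (simp add: matrix_inv_orthogonal matrix_vector_mul_assoc orthogonal_matrix)
    also have "\<dots> = (\<Sum>k\<in>idx l. wigner_D l g k n * sph_harm l k (matrix_inv (transpose g) *v x))"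
      using sph_harm_rotate[OF g n gx] by (simp add: matrix_inv_orthogonal[OF g'])
    also have "\<dots> = (\<Sum>k\<in>idx l. \<Sum>m\<in>idx l. wigner_D l (transpose g) m k * wigner_D l g k n * sph_harm l m x)"
      by (intro sum.cong refl) (simp add: sph_harm_rotate[OF g' _ x] sum_distrib_left mult_ac)
    also have "\<dots> = (\<Sum>m\<in>idx l. (\<Sum>k\<in>idx l. wigner_D l (transpose g) m k * wigner_D l g k n) * sph_harm l m x)"
      unfolding sum_distrib_right by (rule sum.swap)
    finally show ?thesis by simp
  qed
  from sph_harm_coeffs_unique[OF this m] show ?thesis .
qed

subsection \<open>The dimension of the space of steerable kernels\<close>

lemma sum_delta_mult:
  fixes f :: "'a \<Rightarrow> complex"
  assumes "finite A" "k \<in> A"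
  shows "(\<Sum>i\<in>A. (if i = k then 1 else 0) * f i) = f k"
    and "(\<Sum>i\<in>A. (if k = i then 1 else 0) * f i) = f k"
  using assms by (simp_all add: if_distrib[of "\<lambda>c. c * _"] cong: if_cong)

lemma ket_in_coord_space [simp]: "ket i \<in> coord_space I \<longleftrightarrow> i \<in> I"
  by (auto simp: coord_space_def ket_def)

lemma hom_space_expand:
  assumes f: "f \<in> hom_space I I'" and I: "finite I" and v: "v \<in> coord_space I"
  shows "f v k = (\<Sum>i\<in>I. v i * f (ket i) k)"
proof -
  have add: "f (\<lambda>i. u i + w i) = (\<lambda>k. f u k + f w k)" if "u \<in> coord_space I" "w \<in> coord_space I" for u w
    using f that by (simp add: hom_space_def)
  have scale: "f (\<lambda>i. c * w i) = (\<lambda>k. c * f w k)" if "w \<in> coord_space I" for c w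
    using f that by (simp add: hom_space_def)
  have *: "f (\<lambda>k. \<Sum>i\<in>F. v i * ket i k) = (\<lambda>k. \<Sum>i\<in>F. v i * f (ket i) k)" if "finite F" "F \<subseteq> I" for F
    using that
  proof (induction F rule: finite_induct)
    case empty
    have "(\<lambda>i. 0) \<in> coord_space I" by (simp add: coord_space_def)
    from scale[OF this, of 0] show ?case by simp
  next
    case (insert x F)
    have "(\<lambda>k. \<Sum>i\<in>F. v i * ket i k) \<in> coord_space I" "(\<lambda>k. v x * ket x k) \<in> coord_space I"
      using insert.prems by (auto simp: coord_space_def ket_def intro!: sum.neutral)
    from add[OF this(2,1)] show ?case
      using insert scale[of "ket x" "v x"] by simp
  qed
  have "v = (\<lambda>k. \<Sum>i\<in>I. v i * ket i k)"
  proof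
    fix k
    have "(\<Sum>i\<in>I. v i * ket i k) = (\<Sum>i\<in>I. if i = k then v i else 0)"
      by (intro sum.cong) (auto simp: ket_def)
    then show "v k = (\<Sum>i\<in>I. v i * ket i k)" using I v by (simp add: coord_space_def)
  qed
  then show ?thesis using *[OF I order_refl] by metis
qed

section \<open>The Wigner matrices as unitary operators on \<open>V l\<close>\<close>

lemma orthogonal_of_rotation: "rotation_matrix g \<Longrightarrow> orthogonal_matrix g"
  by (simp add: rotation_matrix_def)

lemma wigner_rep_V:
  assumes "orthogonal_matrix g"
  shows "wigner_rep l g v \<in> V l"
  by (simp add: wigner_rep_def coord_space_def wigner_D_outside[OF assms])

lemma wigner_rep_transpose:
  assumes g: "orthogonal_matrix g" and v: "v \<in> V l"
  shows "wigner_rep l (transpose g) (wigner_rep l g v) = v"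
proof
  fix m
  show "wigner_rep l (transpose g) (wigner_rep l g v) m = v m"
  proof (cases "m \<in> idx l")
    case True
    have "wigner_rep l (transpose g) (wigner_rep l g v) m =
        (\<Sum>n\<in>idx l. (\<Sum>k\<in>idx l. wigner_D l (transpose g) m k * wigner_D l g k n) * v n)"
      unfolding wigner_rep_def sum_distrib_left sum_distrib_right
      by (subst sum.swap) (simp only: mult.assoc)
    also have "\<dots> = (\<Sum>n\<in>idx l. (if m = n then 1 else 0) * v n)"
      using True by (intro sum.cong refl) (simp add: wigner_D_transpose_mult[OF g])
    also have "\<dots> = v m" using True by (simp only: sum_delta_mult finite_idx)
    finally show ?thesis .
  next
    case False
    then show ?thesis
      using v wigner_rep_V[of "transpose g" l] g by (simp add: coord_space_def)
  qed
qed

lemma inv_wigner_rep: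
  assumes g: "orthogonal_matrix g" and v: "v \<in> V l"
  shows "inv_into (V l) (wigner_rep l g) (wigner_rep l g v) = v"
  using wigner_rep_transpose[OF g] v by (intro inv_into_f_f inj_on_inverseI)

lemma wigner_rep_surj:
  assumes g: "orthogonal_matrix g" and v: "v \<in> V l"
  obtains w where "w \<in> V l" "v = wigner_rep l g w"
  using wigner_rep_transpose[of "transpose g" v l] wigner_rep_V[of "transpose g" l v] g v by auto

text \<open>With H for the conjugate transpose and T for the transpose, D(g)^H = D(g)^H D(g) D(g^T)
  = D(g^T), by the right inverse and the orthonormal columns.\<close>

lemma wigner_D_transpose:
  assumes g: "orthogonal_matrix g" and m: "m \<in> idx l" and n: "n \<in> idx l"
  shows "wigner_D l (transpose g) m n = cnj (wigner_D l g n m)"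
proof -
  have g': "orthogonal_matrix (transpose g)" using g by simp
  have "cnj (wigner_D l g n m) = (\<Sum>k\<in>idx l. (if k = n then 1 else 0) * cnj (wigner_D l g k m))"
    using n by (simp only: sum_delta_mult finite_idx)
  also have "\<dots> = (\<Sum>k\<in>idx l. (\<Sum>j\<in>idx l. wigner_D l g k j * wigner_D l (transpose g) j n) * cnj (wigner_D l g k m))"
    using wigner_D_transpose_mult[OF g' n] by (intro sum.cong refl) simp
  also have "\<dots> = (\<Sum>j\<in>idx l. (\<Sum>k\<in>idx l. wigner_D l g k j * cnj (wigner_D l g k m)) * wigner_D l (transpose g) j n)"
    unfolding sum_distrib_right by (subst sum.swap) (simp only: mult_ac)
  also have "\<dots> = (\<Sum>j\<in>idx l. (if j = m then 1 else 0) * wigner_D l (transpose g) j n)"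
    by (intro sum.cong refl) (simp only: wigner_D_unitary[OF g _ m])
  also have "\<dots> = wigner_D l (transpose g) m n"
    using m by (simp only: sum_delta_mult finite_idx)
  finally show ?thesis ..
qed

lemma wigner_D_unitary_rows:
  assumes g: "orthogonal_matrix g" and m: "m \<in> idx l" and n: "n \<in> idx l"
  shows "(\<Sum>k\<in>idx l. wigner_D l g m k * cnj (wigner_D l g n k)) = (if m = n then 1 else 0)"
  using wigner_D_transpose_mult[of "transpose g" n l m] g m n by (simp add: wigner_D_transpose[OF g])

text \<open>For a rotation g the map \<open>wigner_rep l g\<close> is a bijection of
  \<open>V l\<close>, so writing v as one of its values removes \<open>inv_into\<close>.\<close>

lemma steerable_iff:
  "K \<in> steerable_kernels l J \<longleftrightarrow> K \<in> kernel_space l J \<and>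
    (\<forall>g. rotation_matrix g \<longrightarrow> (\<forall>x \<in> S2. \<forall>v \<in> V l.
      K (g *v x) (wigner_rep l g v) = wigner_rep J g (K x v)))"
proof -
  have "(\<forall>v\<in>V l. K (g *v x) v = wigner_rep J g (K x (inv_into (V l) (wigner_rep l g) v))) \<longleftrightarrow>
      (\<forall>v\<in>V l. K (g *v x) (wigner_rep l g v) = wigner_rep J g (K x v))"
    if g: "orthogonal_matrix g" for g x
    by (metis inv_wigner_rep[OF g] wigner_rep_V[OF g] wigner_rep_surj[OF g])
  then show ?thesis
    unfolding steerable_kernels_def by (simp add: orthogonal_of_rotation cong: imp_cong)
qed

lemma kernel_space_hom: "K \<in> kernel_space l J \<Longrightarrow> x \<in> S2 \<Longrightarrow> K x \<in> hom_space (idx l) (idx J)"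
  by (simp add: kernel_space_def)

lemma hom_space_V: "f \<in> hom_space I I' \<Longrightarrow> v \<in> coord_space I \<Longrightarrow> f v \<in> coord_space I'"
  by (simp add: hom_space_def)

lemma hom_space_outside: "f \<in> hom_space I I' \<Longrightarrow> v \<notin> coord_space I \<Longrightarrow> f v = 0"
  by (simp add: hom_space_def)

lemma steerable_subspace: "kernels.subspace (steerable_kernels l J)"
proof (rule kernels.subspaceI)
  show "0 \<in> steerable_kernels l J"
    by (auto simp: steerable_iff kernel_space_def hom_space_def coord_space_def wigner_rep_def fun_eq_iff)
next
  fix K K' assume "K \<in> steerable_kernels l J" "K' \<in> steerable_kernels l J"
  then show "K + K' \<in> steerable_kernels l J"
    by (auto simp: steerable_iff kernel_space_def hom_space_def coord_space_def wigner_rep_def fun_eq_iff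
        sum.distrib algebra_simps)
next
  fix c K assume "K \<in> steerable_kernels l J"
  then show "kernel_scale c K \<in> steerable_kernels l J"
    by (auto simp: steerable_iff kernel_space_def hom_space_def coord_space_def wigner_rep_def fun_eq_iff
        kernel_scale_def sum_distrib_left algebra_simps)
qed

lemma kernel_sum_apply: "sum F A x v M = (\<Sum>j\<in>A. F j x v M)" for F :: "'i \<Rightarrow> kernel"
  by (induction A rule: infinite_finite_induct) auto

section \<open>The value at the north pole and the dimension bound\<close>

definition north :: "real ^ 3" where
  "north = axis 3 1"

lemma north_S2: "north \<in> S2"
  by (simp add: north_def norm_axis_1)

definition zrot :: "real \<Rightarrow> real ^ 3 ^ 3" where
  "zrot t = vector [vector [cos t, - sin t, 0], vector [sin t, cos t, 0], vector [0, 0, 1]]"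

lemma rotation_zrot: "rotation_matrix (zrot t)"
proof -
  have "cos t * cos t + sin t * sin t = 1" by (metis sin_cos_squared_add3)
  then show ?thesis
    by (simp add: rotation_matrix_def orthogonal_matrix det_3 zrot_def vec_eq_iff forall_3 transpose_def
        matrix_matrix_mult_def mat_def sum_3 algebra_simps)
qed

lemma zrot_north: "zrot t *v north = north"
  by (simp add: zrot_def north_def vec_eq_iff forall_3 matrix_vector_mult_def sum_3 axis_def)

text \<open>Off the axis the azimuth shifts by -t, but only modulo 2 pi, hence the comparison
  through \<open>cis\<close>. On the axis the azimuth carries no information, and the polar factor
  vanishes unless n = 0.\<close>

lemma sph_harm_zrot:
  assumes x: "x \<in> S2"
  shows "sph_harm l n (matrix_inv (zrot t) *v x) = cis (- t) powi n * sph_harm l n x"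
proof -
  let ?y = "matrix_inv (zrot t) *v x"
  have "matrix_inv (zrot t) = transpose (zrot t)"
    by (intro matrix_inv_orthogonal orthogonal_of_rotation rotation_zrot)
  then have z: "?y $ 3 = x $ 3" and w: "azimuthal ?y = cis (- t) * azimuthal x"
    by (simp_all add: zrot_def azimuthal_def matrix_vector_mult_def transpose_def sum_3 complex_eq_iff)
  show ?thesis
  proof (cases "azimuthal x = 0")
    case True
    then have "(x $ 3)\<^sup>2 = 1" using norm_azimuthal[OF x] by simp
    then have "sph_polar l n (x $ 3) = 0" if "n \<noteq> 0"
      using that by (simp add: sph_polar_def assoc_legendre_def)
    then show ?thesis using True by (cases "n = 0") (simp_all add: sph_harm_polar z w)
  next
    case False
    then have "cis (Arg (azimuthal ?y)) = cis (- t) * cis (Arg (azimuthal x))"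
      by (simp add: w cis_Arg sgn_mult)
    then show ?thesis
      by (simp add: sph_harm_polar z power_int_mult_distrib flip: cis_power_int)
  qed
qed

lemma wigner_D_zrot:
  assumes n: "n \<in> idx l" and n': "n' \<in> idx l"
  shows "wigner_D l (zrot t) n' n = (if n' = n then cis (- t) powi n else 0)"
proof (rule wigner_D_eqI[OF orthogonal_of_rotation[OF rotation_zrot] n n', where c = "\<lambda>n'. if n' = n then cis (- t) powi n else 0"])
  fix x :: "real ^ 3" assume "x \<in> S2"
  then show "sph_harm l n (matrix_inv (zrot t) *v x) =
      (\<Sum>n'\<in>idx l. (if n' = n then cis (- t) powi n else 0) * sph_harm l n' x)"
    using n by (simp add: sph_harm_zrot if_distrib[of "\<lambda>c. c * _"] cong: if_cong)
qed

text \<open>The stabilizer of the north pole acts by the distinct characters \<open>n \<mapsto> e\<^sup>-\<^sup>i\<^sup>n\<^sup>t\<close>, so the value of a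
  steerable kernel there is a diagonal matrix.\<close>

lemma steerable_north_diagonal:
  assumes K: "K \<in> steerable_kernels l J" and n: "n \<in> idx l" and M: "M \<in> idx J" and "M \<noteq> n"
  shows "K north (ket n) M = 0"
proof -
  \<comment> \<open>At this angle the characters of n and M differ by the factor
    \<open>cis (- pi)\<close>, which is -1, so the entry equals its own negative.\<close>
  define t where "t = pi / of_int (n - M)"
  have hom: "K north \<in> hom_space (idx l) (idx J)"
    using K north_S2 by (auto simp: steerable_iff intro: kernel_space_hom)
  have "wigner_rep l (zrot t) (ket n) = (\<lambda>i. cis (- t) powi n * ket n i)"
  proof
    fix i
    have "wigner_rep l (zrot t) (ket n) i = (\<Sum>k\<in>idx l. if k = n then wigner_D l (zrot t) i k else 0)"
      unfolding wigner_rep_def by (intro sum.cong) (auto simp: ket_def)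
    also have "\<dots> = cis (- t) powi n * ket n i"
      using n wigner_D_zrot[OF n, of i t] wigner_D_outside[OF orthogonal_of_rotation[OF rotation_zrot], of i l n t]
      by (cases "i \<in> idx l") (auto simp: ket_def)
    finally show "wigner_rep l (zrot t) (ket n) i = cis (- t) powi n * ket n i" .
  qed
  then have "K north (wigner_rep l (zrot t) (ket n)) M = cis (- t) powi n * K north (ket n) M"
    using hom n by (simp add: hom_space_def)
  moreover have "K north (wigner_rep l (zrot t) (ket n)) = wigner_rep J (zrot t) (K north (ket n))"
  proof -
    have "K (zrot t *v north) (wigner_rep l (zrot t) (ket n)) = wigner_rep J (zrot t) (K north (ket n))"
      using K n rotation_zrot north_S2 unfolding steerable_iff by auto
    then show ?thesis by (simp only: zrot_north)
  qed
  moreover have "wigner_rep J (zrot t) (K north (ket n)) M = cis (- t) powi M * K north (ket n) M"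
    unfolding wigner_rep_def using M
    by (simp add: wigner_D_zrot if_distrib[of "\<lambda>c. c * _"] cong: if_cong)
  moreover have "cis (- t) powi n = - (cis (- t) powi M)"
  proof -
    have "cis (- t) powi n = cis (- t) powi (n - M) * cis (- t) powi M"
      by (simp add: power_int_diff)
    moreover have "cis (- t) powi (n - M) = cis (- pi)"
      using \<open>M \<noteq> n\<close> unfolding cis_power_int t_def by simp
    moreover have "cis (- pi) = -1" by (simp add: complex_eq_iff)
    ultimately show ?thesis by simp
  qed
  ultimately show ?thesis by simp
qed

text \<open>Rotations act transitively on the sphere, and equivariance transports the value from the
  pole. Arguments off the sphere or outside \<open>V l\<close> are settled by the zero
  conventions.\<close>

lemma steerable_determined:
  assumes K: "K \<in> steerable_kernels l J" and K': "K' \<in> steerable_kernels l J"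
    and eq: "K north = K' north"
  shows "K = K'"
proof (intro ext)
  fix x v M
  show "K x v M = K' x v M"
  proof (cases "x \<in> S2 \<and> v \<in> V l")
    case True
    then obtain g :: "real ^ 3 ^ 3" where g: "rotation_matrix g" "g *v north = x"
      unfolding north_def using rotation_matrix_exists_basis[of x 3] by auto
    then obtain w where w: "w \<in> V l" "v = wigner_rep l g w"
      using wigner_rep_surj orthogonal_of_rotation True by blast
    have "K (g *v north) (wigner_rep l g w) = K' (g *v north) (wigner_rep l g w)"
    proof -
      have "K (g *v north) (wigner_rep l g w) = wigner_rep J g (K north w)"
        using K g(1) w(1) north_S2 unfolding steerable_iff by blast
      moreover have "K' (g *v north) (wigner_rep l g w) = wigner_rep J g (K' north w)"
        using K' g(1) w(1) north_S2 unfolding steerable_iff by blast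
      ultimately show ?thesis by (simp only: eq)
    qed
    then show ?thesis by (simp only: g(2) w(2))
  next
    case False
    then show ?thesis
      using K K' by (cases "x \<in> S2") (auto simp: steerable_iff kernel_space_def hom_space_def)
  qed
qed

lemma card_idx: "card (idx l) = 2 * l + 1"
  by (simp add: idx_def)

text \<open>Evaluation at the pole is injective on steerable kernels and lands in the span of
  diagonal matrix units. Bounding independent sets yields finiteness together with the
  count.\<close>

lemma steerable_dimension_bound:
  assumes S: "S \<subseteq> steerable_kernels l J" "kernels.independent S"
  shows "finite S \<and> card S \<le> 2 * min l J + 1"
proof -
  \<comment> \<open>The value at the pole is kept as a kernel supported there, so that \<Phi> maps
    the vector space \<open>kernels\<close> to itself; \<open>E n\<close> is the matrix unit in row
    and column n at the pole.\<close>
  define \<Phi> :: "kernel \<Rightarrow> kernel" where "\<Phi> K = (\<lambda>x v M. if x = north then K x v M else 0)" for K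
  define E :: "int \<Rightarrow> kernel" where
    "E n = (\<lambda>x v M. if x = north \<and> M = n \<and> v \<in> V l then v n else 0)" for n
  interpret \<Phi>: Vector_Spaces.linear kernel_scale kernel_scale \<Phi>
    unfolding Vector_Spaces.linear_iff using kernels.vector_space_axioms
    by (auto simp: \<Phi>_def kernel_scale_def fun_eq_iff)
  have inj: "inj_on \<Phi> (steerable_kernels l J)"
  proof (rule inj_onI)
    fix K K' assume KK': "K \<in> steerable_kernels l J" "K' \<in> steerable_kernels l J" and "\<Phi> K = \<Phi> K'"
    then have "K north = K' north" by (auto simp: \<Phi>_def fun_eq_iff split: if_splits)
    then show "K = K'" using KK' steerable_determined by blast
  qed
  have span: "kernels.span S \<subseteq> steerable_kernels l J"
    using S(1) steerable_subspace by (rule kernels.span_minimal)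
  then have inj': "inj_on \<Phi> (kernels.span S)" using inj inj_on_subset by blast
  have "\<Phi> K \<in> kernels.span (E ` idx (min l J))" if K: "K \<in> steerable_kernels l J" for K
  proof -
    have hom: "K north \<in> hom_space (idx l) (idx J)"
      using K north_S2 by (auto simp: steerable_iff intro: kernel_space_hom)
    have "\<Phi> K = (\<Sum>n\<in>idx (min l J). kernel_scale (K north (ket n) n) (E n))"
    proof (intro ext)
      fix x v M
      show "\<Phi> K x v M = (\<Sum>n\<in>idx (min l J). kernel_scale (K north (ket n) n) (E n)) x v M"
      proof (cases "x = north \<and> v \<in> V l")
        case True
        have R: "(\<Sum>n\<in>idx (min l J). kernel_scale (K north (ket n) n) (E n)) x v M =
            (\<Sum>n\<in>idx (min l J). if n = M then K north (ket n) n * v n else 0)"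
          unfolding kernel_sum_apply kernel_scale_def E_def using True by (intro sum.cong) auto
        have L: "\<Phi> K x v M = (\<Sum>n\<in>idx l. v n * K north (ket n) M)"
          unfolding \<Phi>_def using True hom_space_expand[OF hom _, of v M] by simp
        show ?thesis
        proof (cases "M \<in> idx J")
          case MJ: True
          have "(\<Sum>n\<in>idx l. v n * K north (ket n) M) = (\<Sum>n\<in>idx l. if n = M then K north (ket n) n * v n else 0)"
            using steerable_north_diagonal[OF K _ MJ] by (intro sum.cong) auto
          moreover have "M \<in> idx (min l J) \<longleftrightarrow> M \<in> idx l" using MJ by (auto simp: idx_def)
          ultimately show ?thesis unfolding R L by simp
        next
          case False
          have "K north (ket n) M = 0" if "n \<in> idx l" for n
            using hom_space_V[OF hom, of "ket n"] that False by (simp add: coord_space_def[of "idx J"])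
          moreover have "M \<notin> idx (min l J)" using False by (auto simp: idx_def)
          ultimately show ?thesis unfolding R L by simp
        qed
      next
        case False
        then show ?thesis
          using hom_space_outside[OF hom, of v]
          by (auto simp: kernel_sum_apply kernel_scale_def E_def \<Phi>_def)
      qed
    qed
    then show ?thesis
      by (simp only:) (intro kernels.span_sum kernels.span_scale kernels.span_base imageI)
  qed
  then have "\<Phi> ` S \<subseteq> kernels.span (E ` idx (min l J))" using S(1) by blast
  moreover have "kernels.independent (\<Phi> ` S)"
    using S(2) inj' by (rule \<Phi>.independent_injective_image)
  ultimately have "finite (\<Phi> ` S) \<and> card (\<Phi> ` S) \<le> card (E ` idx (min l J))"
    by (intro kernels.independent_span_bound) auto
  moreover have "inj_on \<Phi> S" using inj S(1) inj_on_subset by blast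
  moreover have "card (E ` idx (min l J)) \<le> 2 * min l J + 1"
    using card_image_le[of "idx (min l J)" E] by (simp add: card_idx)
  ultimately show ?thesis by (auto simp: card_image dest: finite_imageD)
qed

subsection \<open>The Clebsch-Gordan kernels\<close>

lemma sum_swap_pairs:
  "(\<Sum>a\<in>A. \<Sum>b\<in>B. \<Sum>c\<in>C. \<Sum>d\<in>D. f a b c d) = (\<Sum>c\<in>C. \<Sum>d\<in>D. \<Sum>a\<in>A. \<Sum>b\<in>B. f a b c d)"
proof -
  have swap: "(\<Sum>a\<in>A. \<Sum>c\<in>C. \<Sum>d\<in>D. h a c d) = (\<Sum>c\<in>C. \<Sum>d\<in>D. \<Sum>a\<in>A. h a c d)" for A :: "'x set" and h
    by (subst sum.swap) (intro sum.cong refl sum.swap)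
  have "(\<Sum>a\<in>A. \<Sum>b\<in>B. \<Sum>c\<in>C. \<Sum>d\<in>D. f a b c d) = (\<Sum>a\<in>A. \<Sum>c\<in>C. \<Sum>d\<in>D. \<Sum>b\<in>B. f a b c d)"
    by (intro sum.cong refl swap)
  then show ?thesis by (simp only: swap)
qed

lemma matrix_element_eq:
  assumes "M \<in> idx J"
  shows "matrix_element J f M n = f (ket n) M"
proof -
  have "matrix_element J f M n = (\<Sum>i\<in>idx J. (if i = M then 1 else 0) * f (ket n) i)"
    unfolding matrix_element_def cinner_def by (intro sum.cong) (auto simp: ket_def)
  then show ?thesis using assms by (simp only: sum_delta_mult finite_idx)
qed

lemma clebsch_gordan_eq:
  assumes "m \<in> idx j" "n \<in> idx l"
  shows "clebsch_gordan \<iota> j l M m n = cnj (\<iota> (ket M) (m, n))"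
proof -
  have "clebsch_gordan \<iota> j l M m n =
      (\<Sum>p\<in>idx j \<times> idx l. (if p = (m, n) then 1 else 0) * cnj (\<iota> (ket M) p))"
    unfolding clebsch_gordan_def cinner_def by (intro sum.cong) (auto simp: tensor_def ket_def split: if_splits)
  then show ?thesis using assms by (simp only: sum_delta_mult finite_idx finite_cartesian_product mem_Sigma_iff)
qed

text \<open>Equivariance of \<iota> trades D_J on the index M for D_j and D_l on the indices m and
  n. D_j is absorbed by the rotated harmonics, and D_l cancels by unitarity.\<close>

lemma clebsch_gordan_kernel_steerable:
  assumes emb: "equivariant_isometric_embedding J j l \<iota>"
    and K: "K \<in> kernel_space l J"
    and entries: "\<And>x M n. x \<in> S2 \<Longrightarrow> M \<in> idx J \<Longrightarrow> n \<in> idx l \<Longrightarrow>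
      K x (ket n) M = (\<Sum>m\<in>idx j. cnj (\<iota> (ket M) (m, n)) * cnj (sph_harm j m x))"
  shows "K \<in> steerable_kernels l J"
  unfolding steerable_iff
proof (intro conjI allI impI ballI ext)
  show "K \<in> kernel_space l J" by (rule K)
  fix g :: "real ^ 3 ^ 3" and x v M
  assume "rotation_matrix g" and x: "x \<in> S2" and v: "v \<in> V l"
  then have g: "orthogonal_matrix g" by (simp add: orthogonal_of_rotation)
  have gx: "g *v x \<in> S2" using g x by (rule orthogonal_matrix_S2)
  have homx: "K x \<in> hom_space (idx l) (idx J)" and homgx: "K (g *v x) \<in> hom_space (idx l) (idx J)"
    using K x gx by (simp_all only: kernel_space_hom)
  define C where "C M m n = \<iota> (ket M) (m, n)" for M m n
  let ?DJ = "wigner_D J g" and ?Dj = "wigner_D j g" and ?Dl = "wigner_D l g"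
  have \<iota>hom: "\<iota> \<in> hom_space (idx J) (idx j \<times> idx l)"
    using emb by (simp add: equivariant_isometric_embedding_def)
  have intertwine: "(\<Sum>M'\<in>idx J. ?DJ M' M * C M' m n) = (\<Sum>a\<in>idx j. \<Sum>b\<in>idx l. ?Dj m a * ?Dl n b * C M a b)"
    if M: "M \<in> idx J" for M m n
  proof -
    have DM: "wigner_rep J g (ket M) M' = ?DJ M' M" for M'
    proof -
      have "wigner_rep J g (ket M) M' = (\<Sum>k\<in>idx J. (if k = M then 1 else 0) * ?DJ M' k)"
        unfolding wigner_rep_def by (intro sum.cong) (auto simp: ket_def)
      then show ?thesis using M by (simp only: sum_delta_mult finite_idx)
    qed
    have "\<iota> (wigner_rep J g (ket M)) = tensor_rep j l g (\<iota> (ket M))"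
      using emb \<open>rotation_matrix g\<close> M by (simp add: equivariant_isometric_embedding_def)
    moreover have "\<iota> (wigner_rep J g (ket M)) (m, n) = (\<Sum>M'\<in>idx J. ?DJ M' M * C M' m n)"
      using hom_space_expand[OF \<iota>hom finite_idx wigner_rep_V[OF g]] by (simp add: DM C_def)
    ultimately show ?thesis
      by (simp add: tensor_rep_def C_def sum.cartesian_product)
  qed
  have rot: "(\<Sum>m\<in>idx j. ?Dj m a * sph_harm j m (g *v x)) = sph_harm j a x" if "a \<in> idx j" for a
    using sph_harm_rotate[OF g that gx] g
    by (simp add: matrix_inv_orthogonal matrix_vector_mul_assoc orthogonal_matrix)
  have adj: "(\<Sum>M'\<in>idx J. cnj (?DJ M' M) * (\<Sum>n\<in>idx l. ?Dl n k * K (g *v x) (ket n) M')) = K x (ket k) M"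
    if M: "M \<in> idx J" and k: "k \<in> idx l" for M k
  proof -
    have "(\<Sum>M'\<in>idx J. cnj (?DJ M' M) * (\<Sum>n\<in>idx l. ?Dl n k * K (g *v x) (ket n) M')) =
        cnj (\<Sum>M'\<in>idx J. ?DJ M' M * (\<Sum>n\<in>idx l. cnj (?Dl n k) * (\<Sum>m\<in>idx j. C M' m n * sph_harm j m (g *v x))))"
      using entries[OF gx] by (simp add: C_def)
    also have "(\<Sum>M'\<in>idx J. ?DJ M' M * (\<Sum>n\<in>idx l. cnj (?Dl n k) * (\<Sum>m\<in>idx j. C M' m n * sph_harm j m (g *v x)))) =
        (\<Sum>M'\<in>idx J. \<Sum>n\<in>idx l. \<Sum>m\<in>idx j. cnj (?Dl n k) * sph_harm j m (g *v x) * (?DJ M' M * C M' m n))"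
      by (simp only: sum_distrib_left mult_ac)
    also have "\<dots> = (\<Sum>n\<in>idx l. \<Sum>m\<in>idx j. \<Sum>M'\<in>idx J. cnj (?Dl n k) * sph_harm j m (g *v x) * (?DJ M' M * C M' m n))"
      by (subst sum.swap) (intro sum.cong refl sum.swap)
    also have "\<dots> = (\<Sum>n\<in>idx l. \<Sum>m\<in>idx j. \<Sum>a\<in>idx j. \<Sum>b\<in>idx l.
        (?Dl n b * cnj (?Dl n k)) * (?Dj m a * sph_harm j m (g *v x)) * C M a b)"
      unfolding sum_distrib_left[symmetric] intertwine[OF M]
      by (simp only: sum_distrib_left mult_ac)
    also have "\<dots> = (\<Sum>a\<in>idx j. \<Sum>b\<in>idx l. \<Sum>n\<in>idx l. \<Sum>m\<in>idx j.
        (?Dl n b * cnj (?Dl n k)) * (?Dj m a * sph_harm j m (g *v x)) * C M a b)"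
      by (rule sum_swap_pairs)
    also have "\<dots> = (\<Sum>a\<in>idx j. \<Sum>b\<in>idx l.
        (\<Sum>n\<in>idx l. ?Dl n b * cnj (?Dl n k)) * (\<Sum>m\<in>idx j. ?Dj m a * sph_harm j m (g *v x)) * C M a b)"
      unfolding sum_product unfolding sum_distrib_right ..
    also have "\<dots> = (\<Sum>a\<in>idx j. \<Sum>b\<in>idx l. (if b = k then 1 else 0) * (sph_harm j a x * C M a b))"
      using wigner_D_unitary[OF g _ k] rot by (intro sum.cong refl) simp
    also have "\<dots> = (\<Sum>a\<in>idx j. C M a k * sph_harm j a x)"
      using k by (simp only: sum_delta_mult finite_idx mult.commute)
    finally show ?thesis using entries[OF x M k] by (simp add: C_def)
  qed
  have equi: "(\<Sum>n\<in>idx l. ?Dl n k * K (g *v x) (ket n) M) = (\<Sum>M'\<in>idx J. ?DJ M M' * K x (ket k) M')"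
    if M: "M \<in> idx J" and k: "k \<in> idx l" for k
  proof -
    define R where "R M' = (\<Sum>n\<in>idx l. ?Dl n k * K (g *v x) (ket n) M')" for M'
    have "(\<Sum>M'\<in>idx J. ?DJ M M' * K x (ket k) M') =
        (\<Sum>M'\<in>idx J. ?DJ M M' * (\<Sum>M''\<in>idx J. cnj (?DJ M'' M') * R M''))"
      using adj[OF _ k] by (intro sum.cong refl) (simp add: R_def)
    also have "\<dots> = (\<Sum>M''\<in>idx J. (\<Sum>M'\<in>idx J. ?DJ M M' * cnj (?DJ M'' M')) * R M'')"
      unfolding sum_distrib_left sum_distrib_right by (subst sum.swap) (simp only: mult.assoc)
    also have "\<dots> = (\<Sum>M''\<in>idx J. (if M = M'' then 1 else 0) * R M'')"
      using wigner_D_unitary_rows[OF g M] by (intro sum.cong refl) simp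
    also have "\<dots> = R M" using M by (simp only: sum_delta_mult finite_idx)
    finally show ?thesis by (simp add: R_def)
  qed
  show "K (g *v x) (wigner_rep l g v) M = wigner_rep J g (K x v) M"
  proof (cases "M \<in> idx J")
    case True
    have "K (g *v x) (wigner_rep l g v) M =
        (\<Sum>n\<in>idx l. wigner_rep l g v n * K (g *v x) (ket n) M)"
      by (rule hom_space_expand[OF homgx finite_idx wigner_rep_V[OF g]])
    also have "\<dots> = (\<Sum>k\<in>idx l. v k * (\<Sum>n\<in>idx l. ?Dl n k * K (g *v x) (ket n) M))"
      unfolding wigner_rep_def sum_distrib_left sum_distrib_right
      by (subst sum.swap) (simp only: mult_ac)
    also have "\<dots> = (\<Sum>k\<in>idx l. v k * (\<Sum>M'\<in>idx J. ?DJ M M' * K x (ket k) M'))"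
      using equi[OF True] by (intro sum.cong refl) simp
    also have "\<dots> = (\<Sum>M'\<in>idx J. ?DJ M M' * (\<Sum>k\<in>idx l. v k * K x (ket k) M'))"
      unfolding sum_distrib_left by (subst sum.swap) (simp only: mult_ac)
    also have "\<dots> = wigner_rep J g (K x v) M"
      unfolding wigner_rep_def by (simp only: hom_space_expand[OF homx finite_idx v])
    finally show ?thesis .
  next
    case False
    then show ?thesis
      using hom_space_V[OF homgx wigner_rep_V[OF g]] wigner_rep_V[OF g] by (simp add: coord_space_def)
  qed
qed

lemma clebsch_gordan_kernels_independent:
  assumes A: "finite A"
    and emb: "\<And>j. j \<in> A \<Longrightarrow> equivariant_isometric_embedding J j l (\<iota> j)"
    and entries: "\<And>j x M n. j \<in> A \<Longrightarrow> x \<in> S2 \<Longrightarrow> M \<in> idx J \<Longrightarrow> n \<in> idx l \<Longrightarrow>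
      K j x (ket n) M = (\<Sum>m\<in>idx j. cnj (\<iota> j (ket M) (m, n)) * cnj (sph_harm j m x))"
    and zero: "(\<Sum>j\<in>A. kernel_scale (a j) (K j)) = 0" and j: "j \<in> A"
  shows "a j = 0"
proof (rule ccontr)
  assume "a j \<noteq> 0"
  have J0: "0 \<in> idx J" by (simp add: idx_def)
  have "\<iota> j (ket 0) (m, n) = 0" if m: "m \<in> idx j" and n: "n \<in> idx l" for m n
  proof -
    have "(\<Sum>j\<in>A. \<Sum>m\<in>idx j. (cnj (a j) * \<iota> j (ket 0) (m, n)) * sph_harm j m x) = 0" if x: "x \<in> S2" for x
    proof -
      have "0 = cnj ((\<Sum>j\<in>A. kernel_scale (a j) (K j)) x (ket n) 0)" unfolding zero by simp
      also have "\<dots> = (\<Sum>j\<in>A. \<Sum>m\<in>idx j. (cnj (a j) * \<iota> j (ket 0) (m, n)) * sph_harm j m x)"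
        unfolding kernel_sum_apply kernel_scale_def
        using entries[OF _ x J0 n] by (simp add: sum_distrib_left mult.assoc)
      finally show ?thesis by simp
    qed
    from sph_harm_independent[OF A this j m] show ?thesis using \<open>a j \<noteq> 0\<close> by simp
  qed
  then have "cinner (idx j \<times> idx l) (\<iota> j (ket 0)) (\<iota> j (ket 0)) = 0"
    unfolding cinner_def by (intro sum.neutral) auto
  moreover have "cinner (idx j \<times> idx l) (\<iota> j (ket 0)) (\<iota> j (ket 0)) = cinner (idx J) (ket 0) (ket 0)"
    using emb[OF j] J0 by (simp add: equivariant_isometric_embedding_def)
  moreover have "cinner (idx J) (ket 0) (ket 0) = 1"
    using J0 by (simp add: cinner_def ket_def if_distrib[of "\<lambda>c. c * _"] if_distrib[of cnj] cong: if_cong)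
  ultimately show False by simp
qed

lemma (in vector_space) independent_family:
  assumes A: "finite A"
    and indep: "\<And>a. (\<Sum>j\<in>A. scale (a j) (K j)) = 0 \<Longrightarrow> (\<forall>j\<in>A. a j = 0)"
  shows "inj_on K A" and "independent (K ` A)"
proof -
  show inj: "inj_on K A"
  proof (rule inj_onI, rule ccontr)
    fix i j assume ij: "i \<in> A" "j \<in> A" "K i = K j" "i \<noteq> j"
    define a where "a = (\<lambda>k. if k = i then 1 else if k = j then -1 else (0::'a))"
    have "(\<Sum>k\<in>A. scale (a k) (K k)) = (\<Sum>k\<in>{i, j}. scale (a k) (K k))"
      using A ij by (intro sum.mono_neutral_right) (auto simp: a_def)
    also have "\<dots> = 0" using ij by (simp add: a_def)
    finally have "a i = 0" using indep ij(1) by blast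
    then show False by (simp add: a_def)
  qed
  show "independent (K ` A)"
  proof (rule independent_if_scalars_zero)
    fix f y assume "(\<Sum>y\<in>K ` A. scale (f y) y) = 0" and "y \<in> K ` A"
    then show "f y = 0" using indep[of "\<lambda>j. f (K j)"] by (auto simp: sum.reindex[OF inj])
  qed (use A in simp)
qed

theorem mainTheorem6:
  fixes l J :: nat
    and \<iota> :: "nat \<Rightarrow> (int \<Rightarrow> complex) \<Rightarrow> (int \<times> int \<Rightarrow> complex)"
    and K :: "nat \<Rightarrow> kernel"
  defines "js \<equiv> {j :: nat. \<bar>int l - int J\<bar> \<le> int j \<and> j \<le> l + J}"
  assumes embedding: "\<And>j. j \<in> js \<Longrightarrow> equivariant_isometric_embedding J j l (\<iota> j)"
    and kernel: "\<And>j. j \<in> js \<Longrightarrow> K j \<in> kernel_space l J"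
    and matrix_elements: "\<And>j x M n. j \<in> js \<Longrightarrow> x \<in> S2 \<Longrightarrow> M \<in> {- int J..int J} \<Longrightarrow> n \<in> {- int l..int l} \<Longrightarrow>
      matrix_element J (K j x) M n =
        (\<Sum>m = - int j..int j. clebsch_gordan (\<iota> j) j l M m n * cnj (sph_harm j m x))"
  shows "inj_on K js \<and> kernels.independent (K ` js) \<and>
    kernels.span (K ` js) = steerable_kernels l J"
proof -
  have js: "js = {nat \<bar>int l - int J\<bar>..l + J}" by (auto simp: js_def)
  then have fin: "finite js" by simp
  have card_js: "card js = 2 * min l J + 1" by (auto simp: js)
  have entries: "K j x (ket n) M = (\<Sum>m\<in>idx j. cnj (\<iota> j (ket M) (m, n)) * cnj (sph_harm j m x))"
    if "j \<in> js" "x \<in> S2" "M \<in> idx J" "n \<in> idx l" for j x M n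
  proof -
    have "K j x (ket n) M = (\<Sum>m\<in>idx j. clebsch_gordan (\<iota> j) j l M m n * cnj (sph_harm j m x))"
      using matrix_elements[of j x M n] that matrix_element_eq[OF that(3)] by (simp add: idx_def)
    also have "\<dots> = (\<Sum>m\<in>idx j. cnj (\<iota> j (ket M) (m, n)) * cnj (sph_harm j m x))"
      using that(4) by (intro sum.cong refl) (simp add: clebsch_gordan_eq)
    finally show ?thesis .
  qed
  have indep: "\<forall>j\<in>js. a j = 0" if "(\<Sum>j\<in>js. kernel_scale (a j) (K j)) = 0" for a
    using clebsch_gordan_kernels_independent[where \<iota> = \<iota>, OF fin embedding entries that] by blast
  have inj: "inj_on K js" and ind: "kernels.independent (K ` js)"
    using kernels.independent_family[OF fin indep] by blast+
  have steer: "K ` js \<subseteq> steerable_kernels l J"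
    using clebsch_gordan_kernel_steerable[OF embedding kernel entries] by blast
  have "steerable_kernels l J \<subseteq> kernels.span (K ` js)"
  proof (rule ccontr)
    assume "\<not> steerable_kernels l J \<subseteq> kernels.span (K ` js)"
    then obtain k where k: "k \<in> steerable_kernels l J" "k \<notin> kernels.span (K ` js)" by blast
    then have "kernels.independent (insert k (K ` js))"
      using ind by (simp add: kernels.independent_insertI)
    then have "card (insert k (K ` js)) \<le> 2 * min l J + 1"
      using steerable_dimension_bound[of "insert k (K ` js)" l J] k(1) steer by blast
    moreover have "k \<notin> K ` js" using k(2) kernels.span_base by blast
    ultimately show False using fin by (simp add: card_image[OF inj] card_js)
  qed
  moreover have "kernels.span (K ` js) \<subseteq> steerable_kernels l J"
    using steer steerable_subspace by (rule kernels.span_minimal)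
  ultimately show ?thesis using inj ind by blast
qed

end
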